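(* Let $\gamma$ be the Euler–Mascheroni constant, let $\mu\approx 1.451369$ be the Ramanujan–Soldner constant, and for $n\ge 1$ let $$a_n=\frac1n \operatorname*{Res}_{z=0}\ \exp\left(-n\int_0^z\frac{e^t-1}{t}\,dt\right)\frac{dz}{z^n}.$$ Then: (i) if the series $\sum_{n=1}^\infty a_n e^{-\gamma n}$ converges, its sum is $\ln\mu$; (ii) $\sum_{n=1}^\infty (-1)^{n-1}a_n e^{-\gamma n}=\infty$ (the series diverges to $+\infty$); (iii) $\sum_{n=1}^\infty \frac{a_n}{n}e^{-\gamma n}=\mu-1$; (iv) $\sum_{n=1}^\infty \frac{(-1)^{n-1}a_n}{n}e^{-\gamma n}=1$; (v) $\sum_{n=1}^\infty \frac{(-1)^{n-1}a_n}{n^2}e^{-\gamma n}=\ln 2$.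
   Context: The exponential integral is $\mathrm{Ei}(x)=\ln|x|+\gamma+\int_0^x\frac{e^t-1}{t}\,dt$ for real $x\ne 0$. The Ramanujan–Soldner constant $\mu$ is the unique real number $\mu>1$ with $\mathrm{Ei}(\ln\mu)=0$ (equivalently, the unique real zero of the logarithmic integral $\mathrm{li}(x)=\int_0^x dt/\ln t$). $\operatorname{Res}_{z=0}$ denotes the residue at $0$. *)

theory Defs
  imports "HOL-Complex_Analysis.Complex_Analysis"
begin

(* The interval integral is oriented, so for x < 0 it is the negative of the integral over [x, 0].
   In both integrands below the value at t = 0 is 0 / 0 = 0 instead of the limit 1,
   which does not affect the integrals. *)
definition Ei :: "real \<Rightarrow> real" where
  "Ei x = ln \<bar>x\<bar> + euler_mascheroni + (LBINT t=0..x. (exp t - 1) / t)"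

definition soldner :: real where
  "soldner = (THE \<mu>. \<mu> > 1 \<and> Ei (ln \<mu>) = 0)"

(* The integrand extends to an entire function, so the integral is independent of the path
   from 0 to z; the straight segment is used. *)
definition exp_int :: "complex \<Rightarrow> complex" where
  "exp_int z = contour_integral (linepath 0 z) (\<lambda>t. (exp t - 1) / t)"

(* The residue is a real number, see of_real_res_coeff; Re only turns it into an element of real. *)
definition res_coeff :: "nat \<Rightarrow> real" where
  "res_coeff n = Re (1 / of_nat n * residue (\<lambda>z. exp (- of_nat n * exp_int z) / z ^ n) 0)"

lemma exp_int_holomorphic: "exp_int holomorphic_on UNIV"
proof -
  define f :: "complex \<Rightarrow> complex" where "f = (\<lambda>t. if t = 0 then 1 else (exp t - 1) / t)"
  have f_eq: "f t = (exp t - 1) / t" if "t \<noteq> 0" for t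
    using that by (simp add: f_def)
  have "((\<lambda>t::complex. (exp t - 1) / t) \<longlongrightarrow> 1) (at 0)"
    using DERIV_exp[of "0::complex"] by (simp add: has_field_derivative_iff)
  hence "(f \<longlongrightarrow> f 0) (at 0)"
    by (subst filterlim_cong[OF refl refl, of _ "\<lambda>t. (exp t - 1) / t"])
       (auto simp: f_def eventually_at_filter)
  hence cont0: "isCont f 0"
    by (simp add: isCont_def)
  have diff: "f field_differentiable at t" if "t \<noteq> 0" for t
  proof -
    have "(\<lambda>t. (exp t - 1) / t) holomorphic_on (- {0::complex})"
      by (intro holomorphic_intros) auto
    hence "f holomorphic_on (- {0})"
      by (rule holomorphic_transform) (auto simp: f_eq)
    thus ?thesis
      using that by (auto intro: holomorphic_on_imp_differentiable_at)
  qed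
  have "isCont f t" for t
    using cont0 diff[of t] field_differentiable_imp_continuous_at by (cases "t = 0") auto
  hence "continuous_on UNIV f"
    by (simp add: continuous_at_imp_continuous_on)
  then obtain g where g: "\<And>t. (g has_field_derivative f t) (at t)"
    using holomorphic_convex_primitive[of UNIV "{0}" f] diff by auto
  have "exp_int z = g z - g 0" for z
  proof -
    have "(f has_contour_integral (g z - g 0)) (linepath 0 z)"
      using contour_integral_primitive[of UNIV g f "linepath 0 z"] g by simp
    hence "((\<lambda>x. f (linepath 0 z x) * z) has_integral (g z - g 0)) {0..1}"
      by (simp add: has_contour_integral_linepath)
    hence "((\<lambda>x. (exp (linepath 0 z x) - 1) / linepath 0 z x * z) has_integral (g z - g 0)) {0..1}"
      by (rule has_integral_spike_finite[of "{0}", rotated 2])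
         (auto simp: f_def linepath_def)
    hence "((\<lambda>t. (exp t - 1) / t) has_contour_integral (g z - g 0)) (linepath 0 z)"
      by (simp add: has_contour_integral_linepath)
    thus ?thesis
      unfolding exp_int_def by (rule contour_integral_unique)
  qed
  moreover have "(\<lambda>z. g z - g 0) holomorphic_on UNIV"
    using g by (intro holomorphic_intros) (auto simp: holomorphic_on_def field_differentiable_def)
  ultimately show ?thesis
    by presburger
qed

lemma exp_int_cnj: "exp_int (cnj z) = cnj (exp_int z)"
proof -
  define f :: "complex \<Rightarrow> complex" where "f = (\<lambda>t. (exp t - 1) / t)"
  have "exp_int (cnj z) = contour_integral (cnj \<circ> linepath 0 z) f"
    by (simp add: exp_int_def f_def linepath_cnj')
  also have "\<dots> = cnj (contour_integral (linepath 0 z) (cnj \<circ> f \<circ> cnj))"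
    by (rule contour_integral_cnj) simp
  also have "cnj \<circ> f \<circ> cnj = f"
    by (auto simp: f_def exp_cnj)
  finally show ?thesis
    by (simp only: exp_int_def f_def)
qed

lemma of_real_res_coeff:
  "complex_of_real (res_coeff n) =
     1 / of_nat n * residue (\<lambda>z. exp (- of_nat n * exp_int z) / z ^ n) 0"
proof (cases n)
  case (Suc m)
  define F where "F = (\<lambda>z. exp (- of_nat n * exp_int z))"
  have hol: "F holomorphic_on UNIV"
    unfolding F_def by (intro holomorphic_intros exp_int_holomorphic)
  have "(deriv ^^ k) F holomorphic_on UNIV \<and> (\<forall>z. (deriv ^^ k) F (cnj z) = cnj ((deriv ^^ k) F z))"
    for k
  proof (induction k)
    case 0
    thus ?case
      using hol by (simp add: F_def exp_int_cnj exp_cnj)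
  next
    case (Suc k)
    define G where "G = (deriv ^^ k) F"
    have G: "G holomorphic_on UNIV" "\<And>z. G (cnj z) = cnj (G z)"
      using Suc by (auto simp: G_def)
    have "deriv G (cnj z) = cnj (deriv G z)" for z
    proof -
      have "(G has_field_derivative deriv G z) (at z)"
        using G(1) holomorphic_derivI[of G UNIV z] by auto
      hence "(cnj \<circ> G \<circ> cnj has_field_derivative cnj (deriv G z)) (at (cnj z))"
        using has_field_derivative_cnj_cnj[of G "deriv G z" "cnj z"] by simp
      moreover have "cnj \<circ> G \<circ> cnj = G"
        by (auto simp: G(2))
      ultimately show ?thesis
        by (simp add: DERIV_imp_deriv)
    qed
    moreover have "deriv G holomorphic_on UNIV"
      using G(1) by (intro holomorphic_deriv) auto
    ultimately show ?case
      by (simp add: G_def)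
  qed
  hence real_deriv: "(deriv ^^ m) F 0 \<in> \<real>"
    by (metis Reals_cnj_iff complex_cnj_zero)
  have "residue (\<lambda>z. F z / z ^ n) 0 = (deriv ^^ m) F 0 / fact m"
    using residue_holomorphic_over_power[of UNIV 0 F m] hol Suc by simp
  also have "\<dots> \<in> \<real>"
    using real_deriv by (metis Reals_divide of_real_fact Reals_of_real)
  finally have "1 / of_nat n * residue (\<lambda>z. F z / z ^ n) 0 \<in> \<real>"
    by (metis Reals_1 Reals_divide Reals_mult Reals_of_nat)
  thus ?thesis
    unfolding res_coeff_def F_def by (rule of_real_Re)
qed (simp add: res_coeff_def)

end

theory Submission
  imports Defs
begin

text \<open>
  Put \<open>Ein y = \<integral>\<^sub>0\<^sup>y (1 - e\<^sup>-\<^sup>t)/t dt\<close> and \<open>H y = y exp (- Ein y)\<close>. By Lagrange inversion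
  \<open>(-1)\<^sup>n\<^sup>-\<^sup>1 a\<^sub>n\<close> is the \<open>n\<close>-th coefficient \<open>b\<^sub>n\<close> of the inverse \<open>f\<close> of \<open>H\<close>. Since
  \<open>v f' = f exp f\<close>, a recursion with positive coefficients gives \<open>b\<^sub>n \<ge> 0\<close>, and comparing the
  partial sums with the differential equation shows that the series converges below
  \<open>sup H = exp (-\<gamma>)\<close>. The same equation gives
  \<open>\<Sum> b\<^sub>n v\<^sup>n / n = 1 - exp (- f v)\<close> and \<open>\<Sum> b\<^sub>n v\<^sup>n / n\<^sup>2 = Ein (2 f v) - Ein (f v)\<close>.
  As \<open>v\<close> increases to \<open>exp (-\<gamma>)\<close>, \<open>f v\<close> tends to infinity; as \<open>v\<close> decreases to \<open>- exp (-\<gamma>)\<close>,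
  it tends to \<open>- ln \<mu>\<close>, because \<open>exp (Ei x) = - exp \<gamma> \<cdot> H (- x)\<close> for \<open>x > 0\<close>. Abel's theorem, and for
  non-negative coefficients its elementary converse, yield all five claims.
\<close>

unbundle no vec_syntax

section \<open>Lagrange inversion and the formal power series\<close>

text \<open>As \<open>h\<close> has no constant term, \<open>h ^ j\<close> starts at degree
  \<open>j\<close>, so all inner sums may run up to the common bound \<open>m\<close> and the
  summations can be swapped.\<close>

lemma fps_compose_mult_nth:
  fixes F h A :: "'a::comm_ring_1 fps"
  assumes "h $ 0 = 0"
  shows "((F oo h) * A) $ m = (\<Sum>j\<le>m. F $ j * (h ^ j * A) $ m)"
proof -
  have "((F oo h) * A) $ m = (\<Sum>i\<le>m. (\<Sum>j\<le>i. F $ j * h ^ j $ i) * A $ (m - i))"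
    by (simp add: fps_mult_nth fps_compose_nth atLeast0AtMost)
  also have "\<dots> = (\<Sum>i\<le>m. (\<Sum>j\<le>m. F $ j * h ^ j $ i) * A $ (m - i))"
    using startsby_zero_power_prefix[OF assms]
    by (intro sum.cong refl arg_cong2[where f = "(*)"] sum.mono_neutral_left) auto
  also have "\<dots> = (\<Sum>i\<le>m. \<Sum>j\<le>m. F $ j * (h ^ j $ i * A $ (m - i)))"
    by (simp add: sum_distrib_right mult.assoc)
  also have "\<dots> = (\<Sum>j\<le>m. F $ j * (h ^ j * A) $ m)"
    by (subst sum.swap) (simp add: fps_mult_nth atLeast0AtMost sum_distrib_left)
  finally show ?thesis .
qed

text \<open>
  Differentiating \<open>g oo h = X\<close>, multiplying by \<open>\<phi>\<^sup>n\<close> and taking the coefficient of \<open>X\<^sup>n\<^sup>-\<^sup>1\<close> leaves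
  a single term: for \<open>m = n - 1 - j > 0\<close>, \<open>h\<^sup>j h' \<phi>\<^sup>n = X\<^sup>j (\<phi>\<^sup>m - X (\<phi>\<^sup>m)' / m)\<close>, in which the coefficient
  of \<open>X\<^sup>n\<^sup>-\<^sup>1\<close> vanishes.
\<close>
theorem fps_lagrange_inversion:
  fixes \<phi> :: "'a::field_char_0 fps"
  assumes "\<phi> $ 0 \<noteq> 0" "n > 0"
  shows "of_nat n * fps_inv (fps_X * inverse \<phi>) $ n = \<phi> ^ n $ (n - 1)"
proof -
  define h where "h = fps_X * inverse \<phi>"
  define g where "g = fps_inv h"
  have h0: "h $ 0 = 0" and h1: "h $ 1 \<noteq> 0"
    using assms by (simp_all add: h_def)
  have gh: "g oo h = fps_X"
    unfolding g_def by (rule fps_inv[OF h0 h1])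
  have inv: "inverse \<phi> * \<phi> = 1"
    using assms by (simp add: inverse_mult_eq_1)
  have dh: "fps_deriv h * \<phi> ^ 2 = \<phi> - fps_X * fps_deriv \<phi>"
  proof -
    have "fps_deriv h = inverse \<phi> - fps_X * (fps_deriv \<phi> * (inverse \<phi>)\<^sup>2)"
      using assms by (simp add: h_def fps_inverse_deriv)
    hence "fps_deriv h * \<phi>\<^sup>2 = (inverse \<phi> - fps_X * (fps_deriv \<phi> * (inverse \<phi>)\<^sup>2)) * \<phi>\<^sup>2"
      by simp
    also have "\<dots> = (inverse \<phi> * \<phi>) * \<phi> - fps_X * (fps_deriv \<phi> * ((inverse \<phi>)\<^sup>2 * \<phi>\<^sup>2))"
      by (simp only: left_diff_distrib power2_eq_square mult.assoc)
    also have "\<dots> = \<phi> - fps_X * fps_deriv \<phi>"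
      by (simp add: inv flip: power_mult_distrib)
    finally show ?thesis .
  qed
  have hpow: "h ^ j * \<phi> ^ j = fps_X ^ j" for j
  proof -
    have "h * \<phi> = fps_X"
      by (simp add: h_def mult.assoc inv)
    thus ?thesis
      by (simp flip: power_mult_distrib)
  qed
  have key: "(h ^ j * (fps_deriv h * \<phi> ^ n)) $ (n - 1) = (if j = n - 1 then 1 else 0)"
    if "j < n" for j
  proof -
    obtain m where m: "n = j + m + 1"
      using less_imp_Suc_add[OF \<open>j < n\<close>] by auto
    have fac: "h ^ j * (fps_deriv h * \<phi> ^ n) = fps_X ^ j * (fps_deriv h * \<phi> ^ (m + 1))"
    proof -
      have "\<phi> ^ n = \<phi> ^ j * \<phi> ^ (m + 1)"
        by (simp only: m power_add mult.assoc)
      hence "h ^ j * (fps_deriv h * \<phi> ^ n) = (h ^ j * \<phi> ^ j) * (fps_deriv h * \<phi> ^ (m + 1))"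
        by (simp only: mult_ac)
      thus ?thesis
        by (simp only: hpow)
    qed
    have eq: "(h ^ j * (fps_deriv h * \<phi> ^ n)) $ (n - 1) = (fps_deriv h * \<phi> ^ (m + 1)) $ m"
      unfolding fac fps_X_power_mult_nth by (simp add: m)
    show ?thesis
    proof (cases m)
      \<comment> \<open>Here \<open>j = n - 1\<close>, and the constant term of
        \<open>fps_deriv h * \<phi>\<close> is 1 because \<open>fps_deriv h * \<phi> ^ 2\<close> and
        \<open>\<phi>\<close> have the same constant term.\<close>
      case 0
      have "(fps_deriv h * \<phi>\<^sup>2) $ 0 = \<phi> $ 0"
        unfolding dh by simp
      hence "(fps_deriv h * \<phi>) $ 0 = 1"
        using assms by (simp add: power2_eq_square)
      thus ?thesis
        unfolding eq using 0 m by simp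
    next
      case (Suc l)
      have "fps_deriv h * \<phi> ^ (m + 1) = \<phi> ^ m - fps_X * (fps_deriv \<phi> * \<phi> ^ l)"
      proof -
        have "fps_deriv h * \<phi> ^ (m + 1) = (fps_deriv h * \<phi>\<^sup>2) * \<phi> ^ l"
          by (simp add: Suc power2_eq_square mult.assoc)
        also have "\<dots> = \<phi> ^ m - fps_X * (fps_deriv \<phi> * \<phi> ^ l)"
          unfolding dh by (simp only: Suc left_diff_distrib mult.assoc power_Suc)
        finally show ?thesis .
      qed
      moreover have "of_nat m * (fps_deriv \<phi> * \<phi> ^ l) = fps_deriv (\<phi> ^ m)"
        by (simp only: Suc fps_deriv_power fps_of_nat diff_Suc_1 mult.assoc)
      hence "of_nat m * (fps_deriv \<phi> * \<phi> ^ l) $ l = of_nat m * (\<phi> ^ m) $ m"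
        by (metis Suc Suc_eq_plus1 fps_deriv_nth fps_mult_of_nat_nth(1))
      hence "(fps_deriv \<phi> * \<phi> ^ l) $ l = (\<phi> ^ m) $ m"
        by (simp add: Suc del: of_nat_Suc power_Suc)
      ultimately have "(fps_deriv h * \<phi> ^ (m + 1)) $ m = 0"
        by (simp add: Suc fps_X_mult_nth del: power_Suc)
      thus ?thesis
        unfolding eq using m Suc by simp
    qed
  qed
  have "(fps_deriv g oo h) * fps_deriv h = 1"
    using fps_compose_deriv[OF h0, of g] by (simp add: gh)
  hence "\<phi> ^ n = (fps_deriv g oo h) * (fps_deriv h * \<phi> ^ n)"
    by (metis mult.assoc mult_1)
  hence "\<phi> ^ n $ (n - 1) = (\<Sum>j\<le>n - 1. fps_deriv g $ j * (h ^ j * (fps_deriv h * \<phi> ^ n)) $ (n - 1))"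
    using fps_compose_mult_nth[OF h0] by metis
  also have "\<dots> = (\<Sum>j\<le>n - 1. if j = n - 1 then fps_deriv g $ j else 0)"
  proof (intro sum.cong refl)
    fix j assume "j \<in> {..n - 1}"
    hence "j < n"
      using assms by auto
    thus "fps_deriv g $ j * (h ^ j * (fps_deriv h * \<phi> ^ n)) $ (n - 1) = (if j = n - 1 then fps_deriv g $ j else 0)"
      by (subst key) simp_all
  qed
  also have "\<dots> = of_nat n * g $ n"
    using assms by (simp add: sum.delta)
  finally show ?thesis
    by (simp add: g_def h_def)
qed

text \<open>The Taylor series at 0 of the integral of \<open>(1 - exp (- t)) / t\<close>. Division
  by zero makes the coefficient at \<open>n = 0\<close> equal to 0, which is the correct constant
  term.\<close>

definition ein_fps :: "'a::field_char_0 fps" where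
  "ein_fps = Abs_fps (\<lambda>n. (-1) ^ Suc n / (of_nat n * fact n))"

lemma ein_fps_nth_0 [simp]: "ein_fps $ 0 = 0"
  by (simp add: ein_fps_def)

lemma X_deriv_ein_fps: "fps_X * fps_deriv ein_fps = 1 - fps_exp (- 1)"
proof (rule fps_ext)
  fix n
  show "(fps_X * fps_deriv ein_fps) $ n = ((1 - fps_exp (- 1)) $ n :: 'a)"
    by (cases n) (auto simp: ein_fps_def fps_X_mult_nth simp del: of_nat_Suc fact_Suc)
qed

definition exp_ein_fps :: "'a::field_char_0 fps" where
  "exp_ein_fps = fps_exp 1 oo ein_fps"

lemma exp_ein_fps_nth_0 [simp]: "exp_ein_fps $ 0 = 1"
  by (simp add: exp_ein_fps_def)

lemma exp_ein_fps_power: "exp_ein_fps ^ n = fps_exp (of_nat n) oo ein_fps"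
  by (simp add: exp_ein_fps_def fps_compose_power fps_exp_power_mult)

lemma inverse_exp_ein_fps: "inverse exp_ein_fps = fps_exp (-1) oo ein_fps"
  by (simp add: exp_ein_fps_def fps_inverse_compose fps_exp_neg)

text \<open>The series of \<open>y * exp (- Ein y)\<close>, written in the shape that Lagrange
  inversion expects, with \<open>exp_ein_fps\<close> as \<open>\<phi>\<close>.\<close>

definition H_fps :: "'a::field_char_0 fps" where
  "H_fps = fps_X * inverse exp_ein_fps"

lemma H_fps_nth [simp]: "H_fps $ 0 = 0" "H_fps $ Suc 0 = 1"
  by (simp_all add: H_fps_def)

lemma X_deriv_H_fps: "fps_X * fps_deriv H_fps = H_fps * fps_exp (- 1)"
proof -
  have "fps_X * fps_deriv H_fps =
          H_fps - fps_X * inverse exp_ein_fps * (fps_X * fps_deriv ein_fps)"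
    by (simp add: H_fps_def inverse_exp_ein_fps fps_compose_deriv fps_compose_uminus
        algebra_simps flip: fps_const_neg)
  thus ?thesis
    unfolding X_deriv_ein_fps by (simp add: H_fps_def algebra_simps)
qed

definition inv_H_fps :: "'a::field_char_0 fps" where
  "inv_H_fps = fps_inv H_fps"

lemma inv_H_fps_nth_0 [simp]: "inv_H_fps $ 0 = 0"
  by (simp add: inv_H_fps_def fps_inv_def)

lemma inv_H_fps_nth_1 [simp]: "inv_H_fps $ Suc 0 = 1"
  by (simp add: inv_H_fps_def fps_inv_def)

lemma H_compose_inv_H_fps: "H_fps oo inv_H_fps = fps_X"
  unfolding inv_H_fps_def by (rule fps_inv_right) simp_all

lemma fps_exp_compose_minus: 
  assumes "f $ 0 = 0"
  shows "(fps_exp (- c) oo f) * (fps_exp (c::'a::field_char_0) oo f) = 1"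
  by (metis assms fps_compose_1 fps_compose_mult_distrib fps_exp_0 fps_exp_add_mult add.left_inverse)

text \<open>Write \<open>f\<close> for the inverse series. Substituting it into
  \<open>X_deriv_H_fps\<close> gives \<open>f * (H' oo f) = X * exp (- f)\<close>, and the chain
  rule on \<open>H oo f = X\<close> makes \<open>f'\<close> the reciprocal of
  \<open>H' oo f\<close>.\<close>

lemma X_deriv_inv_H_fps: "fps_X * fps_deriv inv_H_fps = inv_H_fps * (fps_exp 1 oo inv_H_fps)"
proof -
  let ?f = "inv_H_fps :: 'a fps"
  have "?f * (fps_deriv H_fps oo ?f) = fps_X * (fps_exp (-1) oo ?f)"
    using arg_cong[OF X_deriv_H_fps, of "\<lambda>F. F oo ?f"]
    by (simp add: fps_compose_mult_distrib H_compose_inv_H_fps)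
  moreover have "(fps_deriv H_fps oo ?f) * fps_deriv ?f = 1"
    using fps_compose_deriv[of ?f H_fps] by (simp add: H_compose_inv_H_fps)
  ultimately have "?f = fps_X * (fps_exp (-1) oo ?f) * fps_deriv ?f"
    by (metis mult.assoc mult.right_neutral)
  hence "?f * (fps_exp 1 oo ?f) =
      fps_X * fps_deriv ?f * ((fps_exp (-1) oo ?f) * (fps_exp 1 oo ?f))"
    by (metis mult.assoc mult.commute)
  thus ?thesis
    by (simp add: fps_exp_compose_minus)
qed

text \<open>The operator \<open>X d/dX\<close> multiplies the coefficient at \<open>n\<close> by
  \<open>n\<close>, and it sends the left side to \<open>exp (- f) * X f' = f\<close>. At
  \<open>n = 0\<close> both sides vanish, on the right through division by zero.\<close>

lemma one_minus_exp_inv_H_fps: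
  "(1 - fps_exp (-1)) oo inv_H_fps = Abs_fps (\<lambda>n. inv_H_fps $ n / of_nat n :: 'a::field_char_0)" (is "?l = ?r")
proof -
  let ?f = "inv_H_fps :: 'a fps"
  have "fps_X * fps_deriv ?l = (fps_exp (-1) oo ?f) * (fps_X * fps_deriv ?f)"
    by (simp add: fps_compose_deriv fps_compose_sub_distrib fps_compose_uminus mult_ac flip: fps_const_neg)
  also have "\<dots> = ?f"
    unfolding X_deriv_inv_H_fps using fps_exp_compose_minus[of ?f 1] by (simp add: mult_ac)
  finally have *: "(fps_X * fps_deriv ?l) $ n = ?f $ n" for n
    by simp
  show ?thesis
  proof (rule fps_ext)
    fix n show "?l $ n = ?r $ n"
      using *[of n] by (cases n) (auto simp: fps_X_mult_nth field_simps simp del: of_nat_Suc)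
  qed
qed

lemma fps_compose_linear_deriv:
  "fps_X * fps_deriv (F oo (fps_const c * fps_X)) = (fps_X * fps_deriv F) oo (fps_const (c::'a::field_char_0) * fps_X)"
  by (simp add: fps_compose_deriv fps_compose_mult_distrib mult_ac)

text \<open>For \<open>K y = Ein (2 y) - Ein y\<close> one has
  \<open>y K' = exp (- y) * (1 - exp (- y))\<close>. After composition with \<open>f\<close> the
  differential equation cancels the exponential, so \<open>X d/dX\<close> leads back to the previous
  series, which brings the second factor \<open>n\<close>.\<close>

lemma ein_diff_inv_H_fps:
  "((ein_fps oo (fps_const 2 * fps_X)) - ein_fps) oo inv_H_fps =
     Abs_fps (\<lambda>n. inv_H_fps $ n / of_nat n ^ 2 :: 'a::field_char_0)" (is "?l = ?r")
proof -
  let ?f = "inv_H_fps :: 'a fps"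
  define K where "K = (ein_fps oo (fps_const 2 * fps_X)) - (ein_fps :: 'a fps)"
  have "fps_X * fps_deriv K =
      fps_X * fps_deriv (ein_fps oo (fps_const 2 * fps_X)) - fps_X * fps_deriv ein_fps"
    unfolding K_def by (subst fps_deriv_sub, rule right_diff_distrib)
  also have "\<dots> = ((1 - fps_exp (-1)) oo (fps_const 2 * fps_X)) - (1 - fps_exp (-1))"
    by (subst fps_compose_linear_deriv, subst (1 2) X_deriv_ein_fps) (rule refl)
  also have "\<dots> = fps_exp (-1) - fps_exp (-2)"
    by (simp add: fps_compose_sub_distrib)
  also have "\<dots> = fps_exp (-1) * (1 - fps_exp (-1))"
    using fps_exp_add_mult[of "-1::'a" "-1"] by (simp add: algebra_simps)
  finally have "(fps_X * fps_deriv K) oo ?f = (fps_exp (-1) * (1 - fps_exp (-1))) oo ?f"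
    by simp
  hence *: "?f * (fps_deriv K oo ?f) = (fps_exp (-1) oo ?f) * ((1 - fps_exp (-1)) oo ?f)"
    by (simp add: fps_compose_mult_distrib)
  have "fps_X * fps_deriv ?l = (fps_deriv K oo ?f) * (fps_X * fps_deriv ?f)"
    unfolding K_def [symmetric] by (simp add: fps_compose_deriv mult.left_commute)
  also have "\<dots> = (?f * (fps_deriv K oo ?f)) * (fps_exp 1 oo ?f)"
    unfolding X_deriv_inv_H_fps by (simp only: mult_ac)
  also have "\<dots> = ((fps_exp (-1) oo ?f) * (fps_exp 1 oo ?f)) * ((1 - fps_exp (-1)) oo ?f)"
    unfolding * by (simp only: mult_ac)
  also have "\<dots> = (1 - fps_exp (-1)) oo ?f"
    by (simp add: fps_exp_compose_minus)
  also have "\<dots> = Abs_fps (\<lambda>n. ?f $ n / of_nat n)"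
    by (rule one_minus_exp_inv_H_fps)
  finally have *: "(fps_X * fps_deriv ?l) $ n = ?f $ n / of_nat n" for n
    by simp
  show ?thesis
  proof (rule fps_ext)
    fix n show "?l $ n = ?r $ n"
      using *[of n] by (cases n) (auto simp: fps_X_mult_nth field_simps power2_eq_square simp del: of_nat_Suc)
  qed
qed

section \<open>Sign of the coefficients of the inverse series\<close>

lemma fps_power_nth_nonneg:
  fixes f :: "'a::linordered_idom fps"
  assumes "\<And>m. m \<le> n \<Longrightarrow> f $ m \<ge> 0"
  shows "f ^ i $ n \<ge> 0"
  using assms
proof (induction i arbitrary: n)
  case (Suc i)
  thus ?case
    by (auto simp: fps_mult_nth intro!: sum_nonneg mult_nonneg_nonneg)
qed auto

lemma inv_H_fps_nonneg: "(inv_H_fps :: real fps) $ n \<ge> 0"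
proof (induction n rule: less_induct)
  case (less n)
  let ?f = "inv_H_fps :: real fps"
  show ?case
  proof (cases "n \<le> 1")
    \<comment> \<open>The recursion below only controls \<open>(n - 1) * ?f $ n\<close>, which
      carries no information at \<open>n = 1\<close>.\<close>
    case True
    thus ?thesis by (cases n) auto
  next
    case False
    \<comment> \<open>Splitting off the linear term of \<open>f exp f\<close>, the rest involves only earlier coefficients.\<close>
    have "?f * (fps_exp 1 oo ?f) = ?f + ?f * ((fps_exp 1 - 1) oo ?f)"
      by (simp add: fps_compose_sub_distrib algebra_simps)
    hence "fps_X * fps_deriv ?f = ?f + ?f * ((fps_exp 1 - 1) oo ?f)"
      by (simp only: X_deriv_inv_H_fps)
    hence "(fps_X * fps_deriv ?f) $ n = ?f $ n + (?f * ((fps_exp 1 - 1) oo ?f)) $ n"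
      by simp
    hence "of_nat n * ?f $ n = ?f $ n + (?f * ((fps_exp 1 - 1) oo ?f)) $ n"
      using False by (cases n) (simp_all add: fps_X_mult_nth)
    \<comment> \<open>The terms \<open>j = 0\<close> and \<open>j = n\<close> vanish because both
      factors have zero constant term. In all others only indices below \<open>n\<close>
      occur.\<close>
    moreover have "?f $ j * ((fps_exp 1 - 1) oo ?f) $ (n - j) \<ge> 0" if "j \<le> n" for j
    proof (cases "j = 0 \<or> j = n")
      case False
      hence "((fps_exp 1 - 1) oo ?f) $ (n - j) \<ge> 0"
        unfolding fps_compose_nth using that
        by (intro sum_nonneg mult_nonneg_nonneg fps_power_nth_nonneg less.IH) auto
      thus ?thesis
        using less.IH[of j] False that by simp
    qed auto
    hence "(?f * ((fps_exp 1 - 1) oo ?f)) $ n \<ge> 0"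
      unfolding fps_mult_nth by (intro sum_nonneg) auto
    ultimately have "(of_nat n - 1) * ?f $ n \<ge> 0"
      by (simp add: algebra_simps)
    thus ?thesis
      using False by (auto simp: zero_le_mult_iff)
  qed
qed

section \<open>The entire function Ein\<close>

definition fps_of_real :: "real fps \<Rightarrow> 'a::real_normed_field fps" where
  "fps_of_real F = Abs_fps (\<lambda>n. of_real (F $ n))"

lemma fps_of_real_nth [simp]: "fps_of_real F $ n = of_real (F $ n)"
  by (simp add: fps_of_real_def)

lemma fps_of_real_power: "fps_of_real (F ^ i) = fps_of_real F ^ i"
proof (induction i)
  case 0
  show ?case by (rule fps_ext) simp
next
  case (Suc i)
  have "fps_of_real (F * F ^ i) = (fps_of_real F * fps_of_real (F ^ i) :: 'a fps)"
    by (rule fps_ext) (simp add: fps_mult_nth)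
  thus ?case
    by (simp add: Suc)
qed

lemma fps_of_real_compose: "fps_of_real (F oo G) = fps_of_real F oo fps_of_real G"
  by (rule fps_ext) (simp add: fps_compose_nth flip: fps_of_real_power)

lemma fps_of_real_ein: "fps_of_real ein_fps = ein_fps"
  by (rule fps_ext) (simp add: ein_fps_def)

lemma conv_radius_fps_of_real:
  "fps_conv_radius (fps_of_real F :: 'a::{banach,real_normed_field} fps) = fps_conv_radius F"
  unfolding fps_conv_radius_def by (subst (1 2) conv_radius_norm [symmetric]) simp

lemma eval_fps_of_real:
  assumes "ereal \<bar>x\<bar> < fps_conv_radius F"
  shows "eval_fps (fps_of_real F) (of_real x :: 'a::{banach,real_normed_field}) = of_real (eval_fps F x)"
proof -
  have "(\<lambda>n. of_real (F $ n * x ^ n) :: 'a) sums of_real (eval_fps F x)"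
    using sums_eval_fps[of x F] assms by (intro sums_of_real) simp
  thus ?thesis
    by (simp add: eval_fps_def sums_iff)
qed

section \<open>Taylor series and derivative of Ein\<close>

lemma conv_radius_ein_fps [simp]:
  "fps_conv_radius (ein_fps :: 'a::{banach,real_normed_field} fps) = \<infinity>"
  unfolding fps_conv_radius_def
proof (rule conv_radius_inftyI'')
  fix z :: 'a
  have "summable (\<lambda>n. norm z ^ n / fact n)"
    using summable_exp[of "norm z"] by (simp add: field_simps)
  moreover have "norm (ein_fps $ n * z ^ n) \<le> norm z ^ n / fact n" for n
  proof (cases n)
    case (Suc m)
    have "norm (ein_fps $ n * z ^ n) = norm z ^ n / fact n / real n"
      by (simp add: ein_fps_def norm_mult norm_divide norm_power del: fact_Suc of_nat_Suc)
    also have "\<dots> \<le> norm z ^ n / fact n / 1"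
      using Suc by (intro divide_left_mono) auto
    finally show ?thesis
      by simp
  qed simp
  ultimately show "summable (\<lambda>n. ein_fps $ n * z ^ n)"
    by (rule summable_comparison_test')
qed

definition Ein :: "'a::{banach,real_normed_field} \<Rightarrow> 'a" where
  "Ein = eval_fps ein_fps"

text \<open>As the sum of the differentiated series, this is also correct at 0, where the quotient
  formula for the derivative breaks down.\<close>

definition Ein' :: "'a::{banach,real_normed_field} \<Rightarrow> 'a" where
  "Ein' = eval_fps (fps_deriv ein_fps)"

lemma Ein_0 [simp]: "Ein 0 = 0"
  by (simp add: Ein_def eval_fps_at_0)

lemma DERIV_Ein: "(Ein has_field_derivative Ein' z) (at z within A)"
  unfolding Ein_def Ein'_def by (rule has_field_derivative_eval_fps) simp

lemmas DERIV_Ein' [derivative_intros] = DERIV_Ein[THEN DERIV_chain2]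

lemma Ein'_times: "z * Ein' z = 1 - exp (- z)"
proof -
  have rad: "fps_conv_radius (fps_deriv ein_fps :: 'a fps) = \<infinity>"
    using fps_conv_radius_deriv[of "ein_fps :: 'a fps"] by simp
  have "eval_fps (fps_X * fps_deriv ein_fps) z = eval_fps (1 - fps_exp (- 1)) z"
    by (simp only: X_deriv_ein_fps)
  thus ?thesis
    by (simp add: eval_fps_mult eval_fps_diff rad Ein'_def)
qed

lemma Ein'_eq: "z \<noteq> 0 \<Longrightarrow> Ein' z = (1 - exp (- z)) / z"
  using Ein'_times[of z] by (simp add: field_simps)

lemma Ein'_minus: "z \<noteq> 0 \<Longrightarrow> Ein' (- z) = (exp z - 1) / z"
  using Ein'_times[of "- z"] by (simp add: field_simps)

lemma continuous_on_Ein': "continuous_on A (Ein' :: 'a \<Rightarrow> 'a::{banach,real_normed_field})"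
  using fps_conv_radius_deriv[of "ein_fps :: 'a fps"]
  unfolding Ein'_def by (intro continuous_on_eval_fps' continuous_intros) auto

lemma Ein_of_real: "Ein (of_real x :: 'a::{banach,real_normed_field}) = of_real (Ein x)"
  using eval_fps_of_real[of x ein_fps, where ?'a = 'a] by (simp add: Ein_def fps_of_real_ein)

section \<open>Link with the integrals and the residue\<close>

lemma exp_int_eq_Ein: "exp_int z = - Ein (- z)"
proof -
  have "((\<lambda>t. - Ein (- t)) has_field_derivative Ein' (- t)) (at t)" for t :: complex
    by (auto intro!: derivative_eq_intros)
  hence "((\<lambda>t. Ein' (- t)) has_contour_integral (- Ein (- z) - (- Ein (- 0)))) (linepath 0 z)"
    using contour_integral_primitive[of UNIV "\<lambda>t. - Ein (- t)" "\<lambda>t. Ein' (- t)" "linepath 0 z"] by simp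
  hence "((\<lambda>x. Ein' (- linepath 0 z x) * z) has_integral - Ein (- z)) {0..1}"
    by (simp add: has_contour_integral_linepath)
  \<comment> \<open>The two integrands differ at most at the parameter \<open>x = 0\<close>, where
    division by zero gives 0.\<close>
  hence "((\<lambda>x. (exp (linepath 0 z x) - 1) / linepath 0 z x * z) has_integral - Ein (- z)) {0..1}"
  proof (rule has_integral_spike_finite[of "{0}", rotated 2])
    fix x :: real assume "x \<in> {0..1} - {0}"
    thus "(exp (linepath 0 z x) - 1) / linepath 0 z x * z = Ein' (- linepath 0 z x) * z"
      by (cases "z = 0") (auto simp: linepath_def Ein'_minus)
  qed auto
  hence "((\<lambda>t. (exp t - 1) / t) has_contour_integral - Ein (- z)) (linepath 0 z)"
    by (simp add: has_contour_integral_linepath)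
  thus ?thesis
    unfolding exp_int_def by (rule contour_integral_unique)
qed

lemma Ei_eq_Ein: "Ei x = ln \<bar>x\<bar> + euler_mascheroni - Ein (- x)"
proof -
  \<comment> \<open>The integral runs over the open interval between 0 and \<open>x\<close>, so the
    value of the quotient at 0 never enters.\<close>
  have "(LBINT t=0..x. (exp t - 1) / t) = (LBINT t=ereal 0..ereal x. Ein' (- t))"
    by (auto simp: zero_ereal_def einterval_iff Ein'_minus min_def max_def split: if_splits
        intro!: interval_integral_cong)
  also have "\<dots> = - Ein (- x) - (- Ein (- 0))"
  proof (rule interval_integral_FTC_finite)
    show "continuous_on {min 0 x..max 0 x} (\<lambda>t. Ein' (- t))"
      by (intro continuous_on_compose2[OF continuous_on_Ein'[of UNIV]] continuous_intros) auto
    show "((\<lambda>t. - Ein (- t)) has_vector_derivative Ein' (- t)) (at t within {min 0 x..max 0 x})" for t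
      unfolding has_real_derivative_iff_has_vector_derivative [symmetric]
      by (auto intro!: derivative_eq_intros)
  qed
  finally show ?thesis
    by (simp add: Ei_def)
qed

text \<open>With \<open>n = Suc k\<close>, the residue is the coefficient of degree \<open>k\<close>
  of \<open>exp (n * Ein (- z))\<close>. The reflection produces the sign, and Lagrange inversion
  supplies a factor \<open>n\<close> that cancels the \<open>1 / n\<close> in
  \<open>res_coeff\<close>.\<close>

lemma res_coeff_eq: "res_coeff (Suc k) = (- 1) ^ k * inv_H_fps $ Suc k"
proof -
  define n where "n = Suc k"
  have "Ein has_fps_expansion (ein_fps :: complex fps)"
    unfolding Ein_def by (rule eval_fps_has_fps_expansion) simp
  hence "((\<lambda>w. exp (of_nat n * w)) \<circ> Ein) has_fps_expansion (fps_exp (of_nat n :: complex) oo ein_fps)"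
    by (intro fps_expansion_intros) simp_all
  moreover have "(\<lambda>z::complex. - z) has_fps_expansion - fps_X"
    by (intro fps_expansion_intros)
  ultimately have "(((\<lambda>w. exp (of_nat n * w)) \<circ> Ein) \<circ> (\<lambda>z. - z))
      has_fps_expansion ((fps_exp (of_nat n :: complex) oo ein_fps) oo - fps_X)"
    by (rule has_fps_expansion_compose) simp
  also have "fps_exp (of_nat n :: complex) oo ein_fps = fps_of_real (exp_ein_fps ^ n)"
    by (simp add: exp_ein_fps_power fps_of_real_compose fps_of_real_ein, rule arg_cong2[where f = fps_compose])
       (auto intro!: fps_ext)
  also have "((\<lambda>w. exp (of_nat n * w)) \<circ> Ein) \<circ> (\<lambda>z. - z) = (\<lambda>z. exp (- of_nat n * exp_int z))"
    by (simp add: fun_eq_iff exp_int_eq_Ein)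
  finally have "residue (\<lambda>z. exp (- of_nat n * exp_int z) / z ^ n) 0
      = (-1) ^ k * of_real (exp_ein_fps ^ n $ k)"
    unfolding n_def by (subst residue_fps_expansion_over_power_at_0, assumption) (simp add: fps_compose_uminus')
  moreover have "real n * inv_H_fps $ n = exp_ein_fps ^ n $ k"
    using fps_lagrange_inversion[of "exp_ein_fps :: real fps" n] by (simp add: inv_H_fps_def H_fps_def n_def)
  ultimately have "residue (\<lambda>z. exp (- of_nat n * exp_int z) / z ^ n) 0
      = complex_of_real ((-1) ^ k * (real n * inv_H_fps $ n))"
    by simp
  moreover have "n \<noteq> 0"
    by (simp add: n_def)
  ultimately have "1 / complex_of_nat n * residue (\<lambda>z. exp (- of_nat n * exp_int z) / z ^ n) 0
      = complex_of_real ((-1) ^ k * inv_H_fps $ n)"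
    by simp
  hence "res_coeff n = (- 1) ^ k * inv_H_fps $ n"
    by (simp only: res_coeff_def Re_complex_of_real)
  thus ?thesis
    by (simp only: n_def)
qed

text \<open>The composite is holomorphic on the whole disc of convergence of \<open>G\<close>, so
  its Taylor series, identified as \<open>\<Phi> oo G\<close>, converges to it there.\<close>

lemma entire_compose_eval_fps:
  fixes F :: "complex \<Rightarrow> complex" and G :: "complex fps"
  assumes "F holomorphic_on UNIV" "F has_fps_expansion \<Phi>" "G $ 0 = 0" "fps_conv_radius G > 0"
  shows "fps_conv_radius (\<Phi> oo G) \<ge> fps_conv_radius G"
    and "norm z < fps_conv_radius G \<Longrightarrow> eval_fps (\<Phi> oo G) z = F (eval_fps G z)"
proof -
  have hol: "F \<circ> eval_fps G holomorphic_on eball 0 (fps_conv_radius G)"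
    using assms by (intro holomorphic_on_compose_gen[where t = UNIV] holomorphic_intros) auto
  have "(F \<circ> eval_fps G) has_fps_expansion (\<Phi> oo G)"
    using assms by (intro has_fps_expansion_compose eval_fps_has_fps_expansion)
  hence eq: "fps_expansion (F \<circ> eval_fps G) 0 = \<Phi> oo G"
    by (simp add: fps_eq_iff fps_nth_fps_expansion fps_expansion_def)
  show "fps_conv_radius (\<Phi> oo G) \<ge> fps_conv_radius G"
    using conv_radius_fps_expansion[OF hol] by (simp only: eq)
  show "eval_fps (\<Phi> oo G) z = F (eval_fps G z)" if "norm z < fps_conv_radius G"
    using eval_fps_expansion'[OF hol that] by (simp add: eq)
qed

text \<open>The detour through the complex numbers is taken because holomorphy controls the radius
  of convergence.\<close>

lemma real_compose_eval_fps:
  fixes F :: "complex \<Rightarrow> complex" and \<Phi> G :: "real fps"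
  assumes "F holomorphic_on UNIV" "F has_fps_expansion fps_of_real \<Phi>"
    and "\<And>x. F (of_real x) = of_real (f x)" "G $ 0 = 0" "ereal \<bar>x\<bar> < fps_conv_radius G"
  shows "(\<lambda>n. (\<Phi> oo G) $ n * x ^ n) sums f (eval_fps G x)"
proof -
  let ?G = "fps_of_real G :: complex fps"
  have rad: "ereal (norm (complex_of_real x)) < fps_conv_radius ?G"
    using assms by (simp add: conv_radius_fps_of_real)
  have pos: "fps_conv_radius ?G > 0"
    using rad by (metis norm_ge_zero ereal_less_eq(5) le_less_trans)
  have "(\<lambda>n. (fps_of_real \<Phi> oo ?G) $ n * of_real x ^ n) sums eval_fps (fps_of_real \<Phi> oo ?G) (of_real x)"
    using entire_compose_eval_fps(1)[OF assms(1,2) _ pos] assms rad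
    by (intro sums_eval_fps) (auto intro: less_le_trans)
  also have "eval_fps (fps_of_real \<Phi> oo ?G) (of_real x) = F (eval_fps ?G (of_real x))"
    using assms rad by (intro entire_compose_eval_fps(2) pos) auto
  also have "\<dots> = of_real (f (eval_fps G x))"
    using assms by (simp add: eval_fps_of_real)
  finally show ?thesis
    by (simp add: sums_of_real_iff flip: fps_of_real_compose of_real_power of_real_mult)
qed

section \<open>The limit defining the radius of convergence\<close>

definition H :: "real \<Rightarrow> real" where
  "H y = y * exp (- Ein y)"

lemma DERIV_H: "(H has_real_derivative exp (- y) * exp (- Ein y)) (at y within A)"
proof -
  have "(H has_real_derivative exp (- Ein y) - y * (exp (- Ein y) * Ein' y)) (at y within A)"
    unfolding H_def [abs_def] by (auto intro!: derivative_eq_intros)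
  also have "exp (- Ein y) - y * (exp (- Ein y) * Ein' y) = (1 - y * Ein' y) * exp (- Ein y)"
    by (simp add: algebra_simps)
  also have "\<dots> = exp (- y) * exp (- Ein y)"
    by (simp add: Ein'_times)
  finally show ?thesis .
qed

lemma H_less_iff [simp]: "H x < H y \<longleftrightarrow> x < y"
proof -
  have "H x < H y" if "x < y" for x y
    by (rule DERIV_pos_imp_increasing[OF that]) (auto intro!: exI[of _ "exp (- _) * exp (- Ein _)"] DERIV_H)
  thus ?thesis
    by (metis less_asym linorder_less_linear)
qed

lemma H_eq_iff [simp]: "H x = H y \<longleftrightarrow> x = y"
  by (metis H_less_iff linorder_less_linear less_irrefl)

lemma H_0 [simp]: "H 0 = 0"
  by (simp add: H_def)

lemma continuous_on_Ein [continuous_intros]: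
  "continuous_on A f \<Longrightarrow> continuous_on A (\<lambda>x. Ein (f x :: real))"
  by (rule continuous_on_compose2[OF DERIV_continuous_on[OF DERIV_Ein]]) auto

text \<open>Both bounds compare derivatives in \<open>t\<close>: \<open>(1 - t / n) ^ n\<close> is
  at most \<open>exp (- t)\<close> and falls short of it by at most
  \<open>exp (- t) * t ^ 2 / n\<close>.\<close>

lemma harm_Ein_bounds:
  assumes "n > 0"
  shows "Ein (real n) \<le> harm n" "harm n - 1 / real n \<le> Ein (real n)"
proof -
  \<comment> \<open>\<open>P\<close> is \<open>\<integral>\<^sub>0\<^sup>t (1 - (1 - s/n)\<^sup>n)/s ds\<close>, which interpolates between \<open>0\<close> and \<open>harm n\<close>.\<close>
  define P where "P t = (\<Sum>k=1..n. (1 - (1 - t / n) ^ k) / k)" for t :: real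
  define D where "D t = (\<Sum>k<n. (1 - t / n) ^ k) / n" for t :: real
  have P': "(P has_real_derivative D t) (at t within A)" for t A
  proof -
    have "(P has_real_derivative (\<Sum>k=1..n. (1 - t / n) ^ (k - 1) / n)) (at t within A)"
      unfolding P_def
    proof (rule DERIV_sum)
      fix k assume "k \<in> {1..n}"
      thus "((\<lambda>t. (1 - (1 - t / n) ^ k) / k) has_real_derivative (1 - t / n) ^ (k - 1) / n) (at t within A)"
        using assms by (auto intro!: derivative_eq_intros)
    qed
    also have "(\<Sum>k=1..n. (1 - t / n) ^ (k - 1) / n) = D t"
      unfolding D_def sum_divide_distrib by (rule sum.reindex_bij_witness[of _ Suc "\<lambda>k. k - 1"]) auto
    finally show ?thesis .
  qed
  have P_0: "P 0 = 0"
    by (simp add: P_def)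
  have P_n: "P n = harm n"
    using assms by (auto simp: P_def harm_def divide_inverse intro!: sum.cong)
  have D: "D t = (1 - (1 - t / n) ^ n) / t" if "t > 0" for t :: real
    using assms that one_diff_power_eq[of "1 - t / n" n] by (simp add: D_def field_simps)
  have up: "(1 - t / n) ^ n \<le> exp (- t)" if "0 < t" "t < n" for t :: real
    using that assms exp_ge_one_minus_x_over_n_power_n by simp
  \<comment> \<open>Bernoulli's inequality is applied to \<open>(1 - (t / n) ^ 2) ^ n\<close>, which
    factors into \<open>(1 - t / n) ^ n * (1 + t / n) ^ n\<close>; the last factor is at most
    \<open>exp t\<close>.\<close>
  have lo: "exp (- t) * (1 - t ^ 2 / n) \<le> (1 - t / n) ^ n" if "0 < t" "t < n" for t :: real
  proof -
    have "(t / n) ^ 2 \<le> 1 ^ 2"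
      using that by (intro power_mono) auto
    hence "1 + n * (- ((t / n) ^ 2)) \<le> (1 + (- ((t / n) ^ 2))) ^ n"
      by (intro Bernoulli_inequality) auto
    also have "1 + (- ((t / n) ^ 2)) = (1 - t / n) * (1 + t / n)"
      by (simp add: algebra_simps power2_eq_square)
    also have "\<dots> ^ n = (1 - t / n) ^ n * (1 + t / n) ^ n"
      by (rule power_mult_distrib)
    also have "\<dots> \<le> (1 - t / n) ^ n * exp t"
      using that assms by (intro mult_left_mono exp_ge_one_plus_x_over_n_power_n) auto
    also have "1 + n * (- ((t / n) ^ 2)) = 1 - t ^ 2 / n"
      using assms by (simp add: field_simps power2_eq_square)
    finally show ?thesis
      by (simp add: exp_minus field_simps)
  qed
  have "P 0 - Ein 0 \<le> P n - Ein (real n)"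
  proof (rule DERIV_nonneg_imp_increasing_open[where f = "\<lambda>t. P t - Ein t"])
    show "continuous_on {0..real n} (\<lambda>t. P t - Ein t)"
      by (intro continuous_intros DERIV_continuous_on[OF P'])
    fix t :: real assume t: "0 < t" "t < n"
    have "((\<lambda>t. P t - Ein t) has_real_derivative D t - Ein' t) (at t)"
      by (intro derivative_intros P' DERIV_Ein)
    moreover have "D t - Ein' t \<ge> 0"
      using t up[of t] by (simp add: D Ein'_eq divide_right_mono)
    ultimately show "\<exists>y. ((\<lambda>t. P t - Ein t) has_real_derivative y) (at t) \<and> 0 \<le> y"
      by blast
  qed auto
  thus "Ein (real n) \<le> harm n"
    by (simp add: P_0 P_n)
  \<comment> \<open>The added term has derivative \<open>- t * exp (- t) / n\<close>, which offsets
    the error bound and makes \<open>Q\<close> non-increasing. Its value at 0 is the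
    \<open>1 / n\<close> of the claim.\<close>
  define Q where "Q t = P t - Ein t + exp (- t) * (t + 1) / n" for t
  have "Q 0 \<ge> Q n"
  proof (rule DERIV_nonpos_imp_decreasing_open[where f = Q])
    show "continuous_on {0..real n} Q"
      unfolding Q_def by (intro continuous_intros DERIV_continuous_on[OF P']) (use assms in auto)
    fix t :: real assume t: "0 < t" "t < n"
    have "(Q has_real_derivative D t - Ein' t - t * exp (- t) / n) (at t)"
      unfolding Q_def using assms
      by (auto intro!: derivative_eq_intros P' simp: field_simps)
    moreover have "D t - Ein' t - t * exp (- t) / n \<le> 0"
    proof -
      have "D t - Ein' t = (exp (- t) - (1 - t / n) ^ n) / t"
        using t by (simp add: D Ein'_eq diff_divide_distrib)
      also have "\<dots> \<le> (exp (- t) * (t ^ 2 / n)) / t"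
        using t lo[of t] by (intro divide_right_mono) (auto simp: algebra_simps)
      also have "\<dots> = t * exp (- t) / n"
        using t by (simp add: power2_eq_square)
      finally show ?thesis by simp
    qed
    ultimately show "\<exists>y. (Q has_real_derivative y) (at t) \<and> y \<le> 0"
      by blast
  qed auto
  hence "harm n - Ein (real n) + exp (- real n) * (real n + 1) / n \<le> 1 / n"
    by (simp add: Q_def P_0 P_n)
  moreover have "exp (- real n) * (real n + 1) / n \<ge> 0"
    by simp
  ultimately show "harm n - 1 / real n \<le> Ein (real n)"
    by linarith
qed

text \<open>For \<open>n > 0\<close>, \<open>H n = exp (- (Ein n - ln n))\<close>, and the harmonic
  bounds squeeze the exponent.\<close>

lemma H_nat_tendsto: "(\<lambda>n. H (real n)) \<longlonglongrightarrow> exp (- euler_mascheroni)"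
proof -
  have "(\<lambda>n. harm n - ln (real n) - 1 / real n) \<longlonglongrightarrow> euler_mascheroni - 0"
    by (intro tendsto_diff euler_mascheroni_LIMSEQ lim_1_over_n)
  hence lim: "(\<lambda>n. harm n - ln (real n) - 1 / real n) \<longlonglongrightarrow> euler_mascheroni"
    by simp
  have "(\<lambda>n. Ein (real n) - ln (real n)) \<longlonglongrightarrow> euler_mascheroni"
  proof (rule tendsto_sandwich[OF _ _ lim euler_mascheroni_LIMSEQ])
    show "\<forall>\<^sub>F n in sequentially. harm n - ln (real n) - 1 / real n \<le> Ein (real n) - ln (real n)"
      using eventually_gt_at_top[of 0] by eventually_elim (use harm_Ein_bounds(2) in force)
    show "\<forall>\<^sub>F n in sequentially. Ein (real n) - ln (real n) \<le> harm n - ln (real n)"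
      using eventually_gt_at_top[of 0] by eventually_elim (use harm_Ein_bounds(1) in force)
  qed
  hence "(\<lambda>n. exp (- (Ein (real n) - ln (real n)))) \<longlonglongrightarrow> exp (- euler_mascheroni)"
    by (intro tendsto_intros)
  moreover have "\<forall>\<^sub>F n in sequentially. exp (- (Ein (real n) - ln (real n))) = H (real n)"
    using eventually_gt_at_top[of 0] by eventually_elim (simp add: H_def exp_diff exp_minus field_simps)
  ultimately show ?thesis
    by (rule Lim_transform_eventually)
qed

lemma H_less: "H y < exp (- euler_mascheroni)"
proof -
  obtain n :: nat where n: "y < real n"
    using reals_Archimedean2 by blast
  have "incseq (\<lambda>n. H (real n))"
    by (auto simp: incseq_def H_less_iff simp flip: not_less)
  hence "H (real n) \<le> exp (- euler_mascheroni)"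
    using H_nat_tendsto by (rule incseq_le)
  thus ?thesis
    using n H_less_iff[of y "real n"] by linarith
qed

lemma H_tendsto_at_top: "(H \<longlongrightarrow> exp (- euler_mascheroni)) at_top"
proof (rule increasing_tendsto)
  fix a :: real assume "a < exp (- euler_mascheroni)"
  then obtain n where n: "a < H (real n)"
    using order_tendstoD(1)[OF H_nat_tendsto] eventually_happens sequentially_bot by blast
  show "\<forall>\<^sub>F y in at_top. a < H y"
    using eventually_gt_at_top[of "real n"] by eventually_elim (use n H_less_iff less_trans in blast)
qed (use H_less in \<open>simp add: less_imp_le\<close>)

lemma Ein_minus_ln_tendsto: "((\<lambda>y::real. Ein y - ln y) \<longlongrightarrow> euler_mascheroni) at_top"
proof -
  have "((\<lambda>y. - ln (H y)) \<longlongrightarrow> - ln (exp (- euler_mascheroni))) at_top"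
    by (intro tendsto_intros H_tendsto_at_top) auto
  moreover have "\<forall>\<^sub>F y in at_top. - ln (H y) = Ein y - ln y"
    using eventually_gt_at_top[of 0] by eventually_elim (simp add: H_def ln_mult)
  ultimately have "((\<lambda>y. Ein y - ln y) \<longlongrightarrow> - ln (exp (- euler_mascheroni))) (at_top :: real filter)"
    by (rule Lim_transform_eventually)
  thus ?thesis
    by simp
qed

text \<open>\<open>Ein y - ln y\<close> has the same limit along \<open>y\<close> and
  \<open>2 * y\<close>, so only \<open>ln (2 * y) - ln y\<close> survives.\<close>

lemma Ein_double_diff_tendsto: "((\<lambda>y::real. Ein (2 * y) - Ein y) \<longlongrightarrow> ln 2) at_top"
proof -
  have "filterlim (\<lambda>y::real. 2 * y) at_top at_top"
    by (rule filterlim_tendsto_pos_mult_at_top[OF tendsto_const _ filterlim_ident]) simp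
  hence "((\<lambda>y::real. Ein (2 * y) - ln (2 * y)) \<longlongrightarrow> euler_mascheroni) at_top"
    by (rule filterlim_compose[OF Ein_minus_ln_tendsto])
  hence "((\<lambda>y::real. (Ein (2 * y) - ln (2 * y)) - (Ein y - ln y) + ln 2) \<longlongrightarrow>
      euler_mascheroni - euler_mascheroni + ln 2) at_top"
    by (intro tendsto_intros Ein_minus_ln_tendsto)
  moreover have "\<forall>\<^sub>F y::real in at_top. (Ein (2 * y) - ln (2 * y)) - (Ein y - ln y) + ln 2 = Ein (2 * y) - Ein y"
    using eventually_gt_at_top[of 0] by eventually_elim (simp add: ln_mult)
  ultimately have "((\<lambda>y::real. Ein (2 * y) - Ein y) \<longlongrightarrow> euler_mascheroni - euler_mascheroni + ln 2) at_top"
    by (rule Lim_transform_eventually)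
  thus ?thesis
    by simp
qed

section \<open>Existence and uniqueness of the Soldner constant\<close>

lemma soldner_props: "soldner > 1" "H (- ln soldner) = - exp (- euler_mascheroni)"
proof -
  \<comment> \<open>This turns the zero of \<open>Ei\<close> into a preimage under \<open>H\<close>,
    whose injectivity later gives uniqueness.\<close>
  have Ei: "Ei (ln \<mu>) = 0 \<longleftrightarrow> H (- ln \<mu>) = - exp (- euler_mascheroni)" if "\<mu> > 1" for \<mu>
  proof -
    have "H (- ln \<mu>) = - exp (ln (ln \<mu>) - Ein (- ln \<mu>))"
      using that by (simp add: H_def exp_diff exp_minus field_simps)
    also have "\<dots> = - exp (Ei (ln \<mu>) - euler_mascheroni)"
      using that by (simp add: Ei_eq_Ein)
    finally show ?thesis
      by auto
  qed
  \<comment> \<open>This prepares the intermediate value theorem on \<open>[-1, 0]\<close>: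
    \<open>Ein (-1) \<le> 0\<close> forces \<open>H (-1) \<le> -1\<close>, below the target
    value.\<close>
  have "Ein (-1) \<le> Ein (0::real)"
  proof (rule DERIV_nonneg_imp_increasing_open[where f = Ein])
    fix x :: real assume "- 1 < x" "x < 0"
    hence "Ein' x \<ge> 0"
      by (simp add: Ein'_eq zero_le_divide_iff)
    thus "\<exists>y. (Ein has_real_derivative y) (at x) \<and> 0 \<le> y"
      using DERIV_Ein by blast
  qed (auto intro!: continuous_intros)
  hence "exp 0 \<le> exp (- Ein (- 1 :: real))"
    by (subst exp_le_cancel_iff) simp
  moreover have "exp (- euler_mascheroni) < (1::real)"
    using euler_mascheroni_pos by simp
  ultimately have "H (-1) \<le> - exp (- euler_mascheroni)"
    by (simp add: H_def)
  moreover have "- exp (- euler_mascheroni) \<le> H 0"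
    by simp
  ultimately obtain x where x: "-1 \<le> x" "x \<le> 0" "H x = - exp (- euler_mascheroni)"
    using IVT'[of H "-1" _ 0] DERIV_continuous_on[OF DERIV_H] by fastforce
  have "x \<noteq> 0"
    using x by auto
  define \<mu> where "\<mu> = exp (- x)"
  have "\<exists>!\<mu>. \<mu> > 1 \<and> Ei (ln \<mu>) = 0"
  proof (rule ex1I[of _ \<mu>])
    show "\<mu> > 1 \<and> Ei (ln \<mu>) = 0"
      using x \<open>x \<noteq> 0\<close> Ei[of \<mu>] by (simp add: \<mu>_def)
    fix \<nu> assume \<nu>: "\<nu> > 1 \<and> Ei (ln \<nu>) = 0"
    hence "H (- ln \<nu>) = H x"
      using x Ei[of \<nu>] by simp
    hence "x = - ln \<nu>"
      by simp
    thus "\<nu> = \<mu>"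
      using \<nu> by (simp add: \<mu>_def)
  qed
  hence "soldner > 1 \<and> Ei (ln soldner) = 0"
    unfolding soldner_def by (rule theI')
  thus "soldner > 1" "H (- ln soldner) = - exp (- euler_mascheroni)"
    using Ei[of soldner] by auto
qed

section \<open>Convergence of the inverse series\<close>

lemma fps_power_nth_cong:
  assumes "\<And>m. m \<le> n \<Longrightarrow> F $ m = G $ m"
  shows "F ^ i $ n = G ^ i $ n"
  using assms
proof (induction i arbitrary: n)
  case (Suc i)
  thus ?case
    by (auto simp: fps_mult_nth intro!: sum.cong arg_cong2[where f = "(*)"])
qed auto

text \<open>Let \<open>G\<close> be the inverse series cut off after degree \<open>N\<close>. The
  coefficients of \<open>G exp G\<close> are non-negative and up to degree \<open>N\<close> agree
  with those of \<open>f exp f = X f'\<close>; dropping the later ones gives the inequality.\<close>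

lemma partial_sum_times_exp_ge:
  fixes v :: real and N :: nat
  assumes "v \<ge> 0"
  defines "p \<equiv> (\<Sum>n\<le>N. inv_H_fps $ n * v ^ n)"
  shows "(\<Sum>n\<le>N. real n * inv_H_fps $ n * v ^ n) \<le> p * exp p"
proof -
  define G where "G = (fps_cutoff (Suc N) inv_H_fps :: real fps)"
  define c where "c n = ((fps_X * fps_exp 1) oo G) $ n" for n
  have G_nth: "G $ n = (if n \<le> N then inv_H_fps $ n else 0)" for n
    by (simp add: G_def less_Suc_eq_le)
  have sums_G: "(\<lambda>n. G $ n * x ^ n) sums (\<Sum>n\<le>N. inv_H_fps $ n * x ^ n)" for x
    using sums_finite[of "{..N}" "\<lambda>n. G $ n * x ^ n"] by (simp add: G_nth)
  have "fps_conv_radius G = \<infinity>"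
    unfolding fps_conv_radius_def by (rule conv_radius_inftyI'') (use sums_G in \<open>blast dest: sums_summable\<close>)
  moreover have "(\<lambda>z::complex. z * exp z) has_fps_expansion fps_of_real (fps_X * fps_exp 1)"
  proof -
    have "fps_of_real (fps_X * fps_exp 1) = (fps_X * fps_exp 1 :: complex fps)"
    proof (rule fps_ext)
      fix n show "fps_of_real (fps_X * fps_exp 1) $ n = (fps_X * fps_exp 1 :: complex fps) $ n"
        by (cases n) (auto simp: fps_X_mult_nth)
    qed
    moreover have "(\<lambda>z. z * exp z) has_fps_expansion (fps_X * fps_exp 1 :: complex fps)"
      by (intro fps_expansion_intros)
    ultimately show ?thesis
      by simp
  qed
  ultimately have "(\<lambda>n. c n * v ^ n) sums (eval_fps G v * exp (eval_fps G v))"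
    unfolding c_def
    by (intro real_compose_eval_fps[where F = "\<lambda>z. z * exp z" and f = "\<lambda>x. x * exp x"])
       (auto intro!: holomorphic_intros simp: G_nth exp_of_real)
  also have "eval_fps G v = p"
    using sums_G[of v] by (simp add: eval_fps_def p_def sums_iff)
  finally have sums: "(\<lambda>n. c n * v ^ n) sums (p * exp p)" .
  have c_nonneg: "c n \<ge> 0" for n
    unfolding c_def fps_compose_nth
    by (intro sum_nonneg mult_nonneg_nonneg fps_power_nth_nonneg)
       (auto simp: fps_X_mult_nth G_nth inv_H_fps_nonneg)
  have c_eq: "c n = real n * inv_H_fps $ n" if "n \<le> N" for n
  proof -
    have "c n = ((fps_X * fps_exp 1) oo inv_H_fps) $ n"
      unfolding c_def fps_compose_nth using that
      by (intro sum.cong refl arg_cong2[where f = "(*)"] fps_power_nth_cong) (auto simp: G_nth)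
    also have "(fps_X * fps_exp 1) oo inv_H_fps = fps_X * fps_deriv (inv_H_fps :: real fps)"
      by (simp add: fps_compose_mult_distrib X_deriv_inv_H_fps)
    also have "\<dots> $ n = real n * inv_H_fps $ n"
      by (cases n) (auto simp: fps_X_mult_nth)
    finally show ?thesis .
  qed
  have "(\<Sum>n\<le>N. c n * v ^ n) \<le> (\<Sum>n. c n * v ^ n)"
    using sums assms(1) by (intro sum_le_suminf) (auto simp: sums_iff c_nonneg)
  thus ?thesis
    using sums by (simp add: c_eq sums_iff)
qed

text \<open>By the previous inequality, \<open>H (p v) / v\<close> is non-increasing, with limit \<open>1\<close> at \<open>0\<close>.\<close>
lemma H_partial_sum_le:
  fixes v :: real
  assumes "v \<ge> 0"
  shows "H (\<Sum>n\<le>Suc N. inv_H_fps $ n * v ^ n) \<le> v"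
proof -
  \<comment> \<open>For \<open>x \<noteq> 0\<close>, \<open>r x\<close> is the partial sum divided
    by \<open>x\<close>. Thus \<open>Q x\<close> is \<open>H (p x) / x\<close> with the singularity
    at 0 removed.\<close>
  define r where "r x = (\<Sum>n\<le>N. inv_H_fps $ Suc n * x ^ n)" for x :: real
  define r' where "r' x = (\<Sum>n\<le>N. inv_H_fps $ Suc n * (real n * x ^ (n - 1)))" for x :: real
  define Q where "Q x = r x * exp (- Ein (x * r x))" for x :: real
  have p_eq: "(\<Sum>n\<le>Suc N. inv_H_fps $ n * x ^ n) = x * r x" for x :: real
    unfolding sum.atMost_Suc_shift by (simp add: r_def sum_distrib_left mult_ac)
  have xp'_eq: "(\<Sum>n\<le>Suc N. real n * inv_H_fps $ n * x ^ n) = x * (r x + x * r' x)" for x :: real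
  proof -
    have "real (Suc n) * c * x ^ Suc n = x * (c * x ^ n) + x * (x * (c * (real n * x ^ (n - 1))))" for n c
      by (cases n) (auto simp: algebra_simps)
    thus ?thesis
      unfolding sum.atMost_Suc_shift r_def r'_def sum_distrib_left distrib_left sum.distrib [symmetric]
      by (simp del: of_nat_Suc power_Suc)
  qed
  have dr: "(r has_real_derivative r' x) (at x within A)" for x A
    unfolding r_def r'_def by (rule DERIV_sum) (auto intro!: derivative_eq_intros)
  have dQ: "(Q has_real_derivative
      exp (- Ein (x * r x)) * (r' x - r x * Ein' (x * r x) * (r x + x * r' x))) (at x within A)" for x A
    unfolding Q_def by (auto intro!: derivative_eq_intros dr simp: algebra_simps)
  have "Q v \<le> Q 0"
  proof (rule DERIV_nonpos_imp_decreasing_open[where f = Q])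
    fix x assume x: "0 < x" "x < v"
    define p where "p = x * r x"
    define p' where "p' = r x + x * r' x"
    have "x * p' \<le> p * exp p"
      using partial_sum_times_exp_ge[of x "Suc N"] x
      by (simp only: p_eq xp'_eq p_def p'_def less_imp_le)
    hence "x * p' / exp p \<le> p"
      by (simp add: pos_divide_le_eq)
    hence ineq: "exp (- p) * (x * p') \<le> p"
      by (simp add: exp_minus field_simps)
    \<comment> \<open>Multiplication by \<open>x ^ 2\<close> and the identity
      \<open>p * Ein' p = 1 - exp (- p)\<close> reduce the sign of \<open>Q'\<close> to
      \<open>ineq\<close>.\<close>
    have "x ^ 2 * (r' x - r x * Ein' p * p') = x * (x * r' x) - (p * Ein' p) * (x * p')"
      by (simp add: p_def power2_eq_square algebra_simps)
    also have "\<dots> = x * (p' - r x) - (1 - exp (- p)) * (x * p')"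
      by (simp add: p'_def Ein'_times)
    also have "\<dots> = exp (- p) * (x * p') - p"
      by (simp add: p_def algebra_simps)
    also have "\<dots> \<le> 0"
      using ineq by simp
    finally have "r' x - r x * Ein' p * p' \<le> 0"
      using x by (simp add: mult_le_0_iff)
    hence "exp (- Ein p) * (r' x - r x * Ein' p * p') \<le> 0"
      by (simp add: mult_le_0_iff)
    thus "\<exists>y. (Q has_real_derivative y) (at x) \<and> y \<le> 0"
      using dQ unfolding p_def p'_def by blast
  qed (use assms DERIV_continuous_on[OF dQ] in auto)
  also have "Q 0 = 1"
    unfolding Q_def r_def by (simp add: power_0_left sum.delta if_distrib cong: if_cong)
  finally have "v * Q v \<le> v * 1"
    using assms by (intro mult_left_mono)
  thus ?thesis
    unfolding p_eq by (simp add: H_def Q_def mult_ac)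
qed

text \<open>Once \<open>v < H y\<close>, \<open>H_partial_sum_le\<close> and the monotonicity of
  \<open>H\<close> keep all partial sums below \<open>y\<close>; the terms are non-negative.\<close>

lemma summable_inv_H_fps:
  assumes "0 \<le> v" "v < exp (- euler_mascheroni)"
  shows "summable (\<lambda>n. inv_H_fps $ n * v ^ n :: real)"
proof -
  obtain y where y: "v < H y"
    using order_tendstoD(1)[OF H_tendsto_at_top assms(2)] eventually_happens trivial_limit_at_top_linorder
    by blast
  have "(\<Sum>n<N. inv_H_fps $ n * v ^ n) \<le> y" for N
  proof -
    have "(\<Sum>n<N. inv_H_fps $ n * v ^ n) \<le> (\<Sum>n\<le>Suc N. inv_H_fps $ n * v ^ n)"
      using assms by (intro sum_mono2) (auto simp: inv_H_fps_nonneg)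
    also have "H \<dots> < H y"
      using H_partial_sum_le[OF assms(1)] y by (rule le_less_trans)
    hence "(\<Sum>n\<le>Suc N. inv_H_fps $ n * v ^ n) < y"
      by (simp only: H_less_iff)
    finally show ?thesis by simp
  qed
  thus ?thesis
    using assms by (intro bounded_imp_summable[where B = y]) (auto simp: inv_H_fps_nonneg lessThan_Suc_atMost [symmetric] simp del: sum.lessThan_Suc)
qed

lemma conv_radius_inv_H_fps:
  "fps_conv_radius (inv_H_fps :: real fps) \<ge> exp (- euler_mascheroni)"
  unfolding fps_conv_radius_def
proof (rule conv_radius_geI_ex)
  fix r :: real assume "0 < r" "ereal r < exp (- euler_mascheroni)"
  thus "\<exists>z::real. norm z = r \<and> summable (\<lambda>n. inv_H_fps $ n * z ^ n)"
    by (intro exI[of _ r]) (auto intro: summable_inv_H_fps)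
qed

section \<open>The sum of the inverse series and its identities\<close>

definition inv_H :: "real \<Rightarrow> real" where
  "inv_H = eval_fps inv_H_fps"

lemma inv_H_sums:
  assumes v: "\<bar>v\<bar> < exp (- euler_mascheroni)"
  shows "(\<lambda>n. inv_H_fps $ n * v ^ n) sums inv_H v"
  unfolding inv_H_def using v
  by (intro sums_eval_fps less_le_trans[OF _ conv_radius_inv_H_fps]) auto

text \<open>\<open>\<Psi>\<close> and \<open>C\<close> enter through equations, so that each use can
  present the complex expansion and the composite in its own form.\<close>

lemma compose_inv_H_sums:
  assumes v: "\<bar>v\<bar> < exp (- euler_mascheroni)"
    and "F holomorphic_on UNIV" "F has_fps_expansion \<Psi>" "\<Psi> = fps_of_real \<Phi>"
    and "\<And>x. F (of_real x) = of_real (f x)" "\<Phi> oo inv_H_fps = C"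
  shows "(\<lambda>n. C $ n * v ^ n) sums f (inv_H v)"
  using real_compose_eval_fps[of F \<Phi> f inv_H_fps v] less_le_trans[OF _ conv_radius_inv_H_fps] assms v
  by (auto simp: inv_H_def)

lemma Ein_has_fps_expansion: "Ein has_fps_expansion (ein_fps :: complex fps)"
  unfolding Ein_def by (rule eval_fps_has_fps_expansion) simp

lemma Ein_holomorphic: "Ein holomorphic_on A"
  unfolding Ein_def by (intro holomorphic_intros) auto

text \<open>The formal identity \<open>H_compose_inv_H_fps\<close> is evaluated at
  \<open>v\<close>.\<close>

lemma H_inv_H:
  assumes v: "\<bar>v\<bar> < exp (- euler_mascheroni)"
  shows "H (inv_H v) = v"
proof -
  have "(\<lambda>n. fps_X $ n * v ^ n) sums H (inv_H v)"
  proof (rule compose_inv_H_sums[OF v, where F = "\<lambda>z. z * ((\<lambda>w. exp (- w)) \<circ> Ein) z"])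
    show "(\<lambda>z::complex. z * ((\<lambda>w. exp (- w)) \<circ> Ein) z) has_fps_expansion
        (fps_X * (fps_exp (-1) oo ein_fps))"
      by (intro fps_expansion_intros Ein_has_fps_expansion) simp
    have "(fps_exp (-1) oo ein_fps :: complex fps) = fps_of_real (fps_exp (-1)) oo fps_of_real ein_fps"
      unfolding fps_of_real_ein by (rule arg_cong2[where f = fps_compose]) (auto intro!: fps_ext)
    also have "\<dots> = fps_of_real (inverse exp_ein_fps)"
      by (simp add: inverse_exp_ein_fps fps_of_real_compose)
    finally show "fps_X * (fps_exp (-1) oo ein_fps) = (fps_of_real H_fps :: complex fps)"
      by (auto simp: H_fps_def fps_X_mult_nth intro!: fps_ext)
  qed (auto intro!: holomorphic_intros Ein_holomorphic H_compose_inv_H_fps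
      simp: o_def H_def Ein_of_real simp flip: exp_of_real)
  moreover have "(\<lambda>n. fps_X $ n * v ^ n) = (\<lambda>n. if n = 1 then v ^ n else 0)"
    by (auto simp: fps_X_def)
  hence "(\<lambda>n. fps_X $ n * v ^ n) sums v"
    using sums_single[of 1 "\<lambda>n. v ^ n"] by simp
  ultimately show ?thesis
    using sums_unique2 by blast
qed

lemma one_minus_exp_inv_H_sums:
  assumes v: "\<bar>v\<bar> < exp (- euler_mascheroni)"
  shows "(\<lambda>n. inv_H_fps $ n / real n * v ^ n) sums (1 - exp (- inv_H v))"
proof -
  have "(\<lambda>n. Abs_fps (\<lambda>n. inv_H_fps $ n / real n) $ n * v ^ n) sums (1 - exp (- inv_H v))"
  proof (rule compose_inv_H_sums[OF v, where F = "\<lambda>z. 1 - exp (- z)"])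
    show "(\<lambda>z::complex. 1 - exp (- z)) has_fps_expansion (1 - fps_exp (-1) :: complex fps)"
      by (intro fps_expansion_intros)
    show "(1 - fps_exp (-1)) oo inv_H_fps = Abs_fps (\<lambda>n. inv_H_fps $ n / real n)"
      using one_minus_exp_inv_H_fps[where ?'a = real] by simp
  qed (auto intro!: holomorphic_intros fps_ext simp flip: exp_of_real)
  thus ?thesis
    by simp
qed

lemma Ein_diff_inv_H_sums:
  assumes v: "\<bar>v\<bar> < exp (- euler_mascheroni)"
  shows "(\<lambda>n. inv_H_fps $ n / real n ^ 2 * v ^ n) sums (Ein (2 * inv_H v) - Ein (inv_H v))"
proof -
  have "(\<lambda>n. Abs_fps (\<lambda>n. inv_H_fps $ n / real n ^ 2) $ n * v ^ n) sums
      (Ein (2 * inv_H v) - Ein (inv_H v))"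
  proof (rule compose_inv_H_sums[OF v, where F = "\<lambda>z. (Ein \<circ> (\<lambda>z. 2 * z)) z - Ein z"])
    show "(\<lambda>z::complex. (Ein \<circ> (\<lambda>z. 2 * z)) z - Ein z) has_fps_expansion
        ((ein_fps oo (fps_const 2 * fps_X)) - ein_fps)"
      by (intro fps_expansion_intros Ein_has_fps_expansion) simp
    have "fps_const 2 * fps_X = (fps_of_real (fps_const 2 * fps_X) :: complex fps)"
      by (rule fps_ext) (simp add: fps_X_def)
    hence "(ein_fps oo (fps_const 2 * fps_X)) - ein_fps =
        fps_of_real (ein_fps oo (fps_const 2 * fps_X)) - (fps_of_real ein_fps :: complex fps)"
      by (simp only: fps_of_real_compose fps_of_real_ein)
    also have "\<dots> = fps_of_real ((ein_fps oo (fps_const 2 * fps_X)) - ein_fps)"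
      by (auto intro!: fps_ext)
    finally show "(ein_fps oo (fps_const 2 * fps_X)) - ein_fps =
        (fps_of_real ((ein_fps oo (fps_const 2 * fps_X)) - ein_fps) :: complex fps)" .
    show "((ein_fps oo (fps_const 2 * fps_X)) - ein_fps) oo inv_H_fps = Abs_fps (\<lambda>n. inv_H_fps $ n / real n ^ 2)"
      using ein_diff_inv_H_fps[where ?'a = real] by simp
    fix x show "(Ein \<circ> (\<lambda>z. 2 * z)) (complex_of_real x) - Ein (of_real x) = of_real (Ein (2 * x) - Ein x)"
      using Ein_of_real[of "2 * x", where ?'a = complex] by (simp add: Ein_of_real)
    show "(\<lambda>z. (Ein \<circ> (\<lambda>z. 2 * z)) z - Ein z :: complex) holomorphic_on UNIV"
      by (intro holomorphic_intros holomorphic_on_compose Ein_holomorphic)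
  qed
  thus ?thesis
    by simp
qed

section \<open>Abel limits and the theorem\<close>

text \<open>For \<open>v < \<rho>\<close> each partial sum is at most \<open>s v\<close>; being a
  polynomial in \<open>v\<close>, it keeps this bound in the limit.\<close>

lemma nonneg_series_le_left_limit:
  fixes c :: "nat \<Rightarrow> real"
  assumes "\<And>n. c n \<ge> 0" "\<rho> > 0"
    and "\<And>v. 0 < v \<Longrightarrow> v < \<rho> \<Longrightarrow> (\<lambda>n. c n * v ^ n) sums s v"
    and "(s \<longlongrightarrow> L) (at_left \<rho>)"
  shows "(\<Sum>n<N. c n * \<rho> ^ n) \<le> L"
proof (rule tendsto_le)
  have ev: "\<forall>\<^sub>F v in at_left \<rho>. 0 < v \<and> v < \<rho>"
    using assms(2) by (auto simp: eventually_at_left_field intro!: exI[of _ 0])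
  thus "\<forall>\<^sub>F v in at_left \<rho>. (\<Sum>n<N. c n * v ^ n) \<le> s v"
  proof eventually_elim
    case (elim v)
    hence "(\<lambda>n. c n * v ^ n) sums s v"
      using assms(3) by blast
    moreover have "(\<Sum>n<N. c n * v ^ n) \<le> (\<Sum>n. c n * v ^ n)"
      using calculation elim assms(1) by (intro sum_le_suminf) (auto simp: sums_iff)
    ultimately show ?case
      by (simp add: sums_iff)
  qed
qed (use assms(4) in \<open>auto intro!: tendsto_intros\<close>)

text \<open>Abel's theorem at radius 1. Summation by parts writes the deviation from
  \<open>S\<close> as \<open>1 - x\<close> times the power series of the errors \<open>D n\<close>.
  The first \<open>N\<close> errors are killed by the factor \<open>1 - x\<close>, the later ones
  are uniformly small.\<close>

lemma abel_limit_scaled: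
  fixes d :: "nat \<Rightarrow> real"
  assumes "d sums S"
  shows "((\<lambda>x. \<Sum>n. d n * x ^ n) \<longlongrightarrow> S) (at_left 1)"
proof -
  define D where "D n = (\<Sum>k\<le>n. d k) - S" for n
  have D_lim: "D \<longlonglongrightarrow> 0"
    using assms unfolding D_def sums_def_le by (intro LIM_zero)
  then obtain B where B: "\<And>n. \<bar>D n\<bar> \<le> B"
    using Bseq_def convergent_imp_Bseq convergentI by (metis real_norm_def)
  have geo: "summable (\<lambda>n. x ^ n)" "(\<Sum>n. x ^ n) = 1 / (1 - x)" if "0 < x" "x < 1" for x :: real
    using that by (auto intro!: summable_geometric suminf_geometric)
  have D_summable: "summable (\<lambda>n. \<bar>D n\<bar> * x ^ n)" if "0 < x" "x < 1" for x
    using that B by (intro summable_comparison_test'[OF summable_mult[OF geo(1)[OF that], of B]])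
      (auto simp: abs_mult intro!: mult_right_mono)
  have identity: "(\<Sum>n. d n * x ^ n) - S = (1 - x) * (\<Sum>n. D n * x ^ n)" if x: "0 < x" "x < 1" for x
  proof -
    have D_summ: "summable (\<lambda>n. D n * x ^ n)"
      using D_summable[OF x] x by (intro summable_norm_cancel[of "\<lambda>n. D n * x ^ n"]) (simp add: abs_mult)
    have "(\<lambda>n. D n * x ^ n + S * x ^ n) sums ((\<Sum>n. D n * x ^ n) + S * (1 / (1 - x)))"
      using D_summ geo[OF x] by (intro sums_add sums_mult) (auto simp: sums_iff)
    moreover define A where "A = (\<Sum>n. D n * x ^ n) + S * (1 / (1 - x))"
    ultimately have P: "(\<lambda>n. (\<Sum>k\<le>n. d k) * x ^ n) sums A"
      by (simp add: D_def algebra_simps)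
    \<comment> \<open>Subtracting \<open>x\<close> times the series from its shift leaves
      \<open>d (Suc n) * x ^ Suc n\<close> in each term.\<close>
    have "(\<lambda>n. (\<Sum>k\<le>Suc n. d k) * x ^ Suc n) sums (A - d 0)"
      using P by (subst sums_Suc_iff) simp
    hence "(\<lambda>n. (\<Sum>k\<le>Suc n. d k) * x ^ Suc n - x * ((\<Sum>k\<le>n. d k) * x ^ n)) sums (A - d 0 - x * A)"
      by (intro sums_diff sums_mult P)
    hence "(\<lambda>n. d (Suc n) * x ^ Suc n) sums (A - d 0 - x * A)"
      by (simp add: algebra_simps)
    hence "(\<lambda>n. d n * x ^ n) sums (A - d 0 - x * A + d 0)"
      by (subst (asm) sums_Suc_iff) simp
    hence "(\<Sum>n. d n * x ^ n) = (1 - x) * A"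
      by (simp add: sums_iff algebra_simps)
    also have "\<dots> = (1 - x) * (\<Sum>n. D n * x ^ n) + S"
      using x by (simp add: A_def distrib_left)
    finally show ?thesis by simp
  qed
  have "((\<lambda>x. (\<Sum>n. d n * x ^ n) - S) \<longlongrightarrow> 0) (at_left 1)"
  proof (rule tendstoI)
    fix e :: real assume "e > 0"
    hence "\<forall>\<^sub>F n in sequentially. \<bar>D n\<bar> < e / 2"
      using tendstoD[OF D_lim, of "e / 2"] by simp
    then obtain N where N: "\<And>n. n \<ge> N \<Longrightarrow> \<bar>D n\<bar> < e / 2"
      by (auto simp: eventually_sequentially)
    define M where "M = (\<Sum>n<N. \<bar>D n\<bar>)"
    have "((\<lambda>x. (1 - x) * M) \<longlongrightarrow> (1 - 1) * M) (at_left 1)"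
      by (intro tendsto_intros)
    hence "\<forall>\<^sub>F x in at_left 1. (1 - x) * M < e / 2"
      using \<open>e > 0\<close> by (intro order_tendstoD) auto
    moreover have "\<forall>\<^sub>F x in at_left (1::real). 0 < x \<and> x < 1"
      by (auto simp: eventually_at_left_field intro!: exI[of _ 0])
    ultimately show "\<forall>\<^sub>F x in at_left 1. dist ((\<Sum>n. d n * x ^ n) - S) 0 < e"
    proof eventually_elim
      case (elim x)
      hence x: "0 < x" "x < 1"
        by auto
      have tail: "\<bar>D n\<bar> * x ^ n \<le> (if n < N then \<bar>D n\<bar> else 0) + e / 2 * x ^ n" for n
      proof (cases "n < N")
        case True
        have "\<bar>D n\<bar> * x ^ n \<le> \<bar>D n\<bar> * 1"
          using x by (intro mult_left_mono power_le_one) auto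
        thus ?thesis
          using True x \<open>e > 0\<close> by (simp add: add_increasing2)
      next
        case False
        thus ?thesis
          using N[of n] x by (auto intro!: mult_right_mono)
      qed
      have "(\<lambda>n. if n < N then \<bar>D n\<bar> else 0) sums M"
        using sums_If_finite[of "\<lambda>n. n < N" "\<lambda>n. \<bar>D n\<bar>"] by (simp add: M_def lessThan_def)
      hence bound: "(\<lambda>n. (if n < N then \<bar>D n\<bar> else 0) + e / 2 * x ^ n) sums (M + e / 2 * (1 / (1 - x)))"
        using geo[OF x] by (intro sums_add sums_mult) (auto simp: sums_iff)
      have "\<bar>\<Sum>n. D n * x ^ n\<bar> \<le> (\<Sum>n. \<bar>D n\<bar> * x ^ n)"
        using summable_norm[of "\<lambda>n. D n * x ^ n"] D_summable[OF x] x by (simp add: abs_mult)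
      also have "\<dots> \<le> M + e / 2 * (1 / (1 - x))"
        using suminf_le[OF tail D_summable[OF x]] bound by (simp add: sums_iff)
      finally have "(1 - x) * \<bar>\<Sum>n. D n * x ^ n\<bar> \<le> (1 - x) * (M + e / 2 * (1 / (1 - x)))"
        using x by (intro mult_left_mono) auto
      also have "\<dots> = (1 - x) * M + e / 2"
        using x by (simp add: field_simps)
      also have "\<dots> < e"
        using elim by simp
      finally show ?case
        using x identity[OF x] by (simp add: abs_mult)
    qed
  qed
  thus ?thesis
    by (simp add: LIM_zero_iff)
qed

text \<open>The substitution \<open>v / \<rho>\<close> reduces this to radius 1, and uniqueness of
  the left limit identifies the sum with \<open>L\<close>.\<close>

lemma abel_limit:
  fixes c :: "nat \<Rightarrow> real"
  assumes "summable (\<lambda>n. c n * \<rho> ^ n)" "\<rho> > 0"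
    and "\<And>v. 0 < v \<Longrightarrow> v < \<rho> \<Longrightarrow> (\<lambda>n. c n * v ^ n) sums s v"
    and "(s \<longlongrightarrow> L) (at_left \<rho>)"
  shows "(\<lambda>n. c n * \<rho> ^ n) sums L"
proof -
  have ev: "\<forall>\<^sub>F v in at_left \<rho>. 0 < v \<and> v < \<rho>"
    using assms(2) by (auto simp: eventually_at_left_field intro!: exI[of _ 0])
  have "filterlim (\<lambda>v. v / \<rho>) (at_left 1) (at_left \<rho>)"
    unfolding filterlim_at
  proof
    show "\<forall>\<^sub>F v in at_left \<rho>. v / \<rho> \<in> {..<1} \<and> v / \<rho> \<noteq> 1"
      using ev by eventually_elim (use assms(2) in auto)
    have "((\<lambda>v. v / \<rho>) \<longlongrightarrow> \<rho> / \<rho>) (at_left \<rho>)"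
      by (intro tendsto_intros) (use assms(2) in auto)
    thus "((\<lambda>v. v / \<rho>) \<longlongrightarrow> 1) (at_left \<rho>)"
      using assms(2) by simp
  qed
  hence "((\<lambda>v. \<Sum>n. (c n * \<rho> ^ n) * (v / \<rho>) ^ n) \<longlongrightarrow> (\<Sum>n. c n * \<rho> ^ n)) (at_left \<rho>)"
    by (rule filterlim_compose[OF abel_limit_scaled[OF summable_sums[OF assms(1)]]])
  moreover have "\<forall>\<^sub>F v in at_left \<rho>. (\<Sum>n. (c n * \<rho> ^ n) * (v / \<rho>) ^ n) = s v"
    using ev by eventually_elim (use assms(2,3) in \<open>simp add: power_divide sums_iff\<close>)
  ultimately have "(s \<longlongrightarrow> (\<Sum>n. c n * \<rho> ^ n)) (at_left \<rho>)"
    by (rule Lim_transform_eventually)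
  hence "(\<Sum>n. c n * \<rho> ^ n) = L"
    using assms(4) tendsto_unique trivial_limit_at_left_real by blast
  thus ?thesis
    using assms(1) by (simp add: sums_iff)
qed

text \<open>Non-negativity bounds the partial sums by \<open>L\<close>, so the series converges and
  Abel's theorem gives its value.\<close>

lemma nonneg_abel_converse:
  fixes c :: "nat \<Rightarrow> real"
  assumes "\<And>n. c n \<ge> 0" "\<rho> > 0"
    and "\<And>v. 0 < v \<Longrightarrow> v < \<rho> \<Longrightarrow> (\<lambda>n. c n * v ^ n) sums s v"
    and "(s \<longlongrightarrow> L) (at_left \<rho>)"
  shows "(\<lambda>n. c n * \<rho> ^ n) sums L"
proof -
  have "summable (\<lambda>n. c n * \<rho> ^ n)"
    using assms(1,2) nonneg_series_le_left_limit[OF assms]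
    by (intro bounded_imp_summable[where B = L]) (auto simp: lessThan_Suc_atMost [symmetric] simp del: sum.lessThan_Suc)
  thus ?thesis
    using assms(2-4) by (rule abel_limit)
qed

text \<open>Some \<open>v < \<rho>\<close> has \<open>s v > Z\<close>, so the partial sums at
  \<open>v\<close> eventually exceed \<open>Z\<close>; those at \<open>\<rho>\<close> are at least
  as large.\<close>

lemma nonneg_abel_at_top:
  fixes c :: "nat \<Rightarrow> real"
  assumes "\<And>n. c n \<ge> 0" "\<rho> > 0"
    and "\<And>v. 0 < v \<Longrightarrow> v < \<rho> \<Longrightarrow> (\<lambda>n. c n * v ^ n) sums s v"
    and "filterlim s at_top (at_left \<rho>)"
  shows "filterlim (\<lambda>N. \<Sum>n<N. c n * \<rho> ^ n) at_top sequentially"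
  unfolding filterlim_at_top_dense
proof
  fix Z
  have ev: "\<forall>\<^sub>F v in at_left \<rho>. 0 < v \<and> v < \<rho>"
    using assms(2) by (auto simp: eventually_at_left_field intro!: exI[of _ 0])
  have "\<forall>\<^sub>F v in at_left \<rho>. s v > Z"
    using assms(4) by (auto simp: filterlim_at_top_dense)
  with ev have "\<forall>\<^sub>F v in at_left \<rho>. 0 < v \<and> v < \<rho> \<and> s v > Z"
    by eventually_elim auto
  then obtain v where v: "0 < v" "v < \<rho>" "s v > Z"
    using eventually_happens trivial_limit_at_left_real by blast
  have "(\<lambda>N. \<Sum>n<N. c n * v ^ n) \<longlonglongrightarrow> s v"
    using assms(3)[OF v(1,2)] by (simp add: sums_def)
  hence "\<forall>\<^sub>F N in sequentially. Z < (\<Sum>n<N. c n * v ^ n)"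
    using v(3) by (rule order_tendstoD)
  thus "\<forall>\<^sub>F N in sequentially. Z < (\<Sum>n<N. c n * \<rho> ^ n)"
  proof eventually_elim
    case (elim N)
    also have "(\<Sum>n<N. c n * v ^ n) \<le> (\<Sum>n<N. c n * \<rho> ^ n)"
      using assms(1) v by (intro sum_mono mult_left_mono power_mono) auto
    finally show ?case .
  qed
qed

lemma inv_H_at_top: "filterlim inv_H at_top (at_left (exp (- euler_mascheroni)))"
  unfolding filterlim_at_top_dense
proof
  fix Z
  have "\<forall>\<^sub>F v in at_left (exp (- euler_mascheroni)). v \<in> {max 0 (H Z)<..<exp (- euler_mascheroni)}"
    using H_less[of Z] by (intro eventually_at_left_real) simp
  thus "\<forall>\<^sub>F v in at_left (exp (- euler_mascheroni)). Z < inv_H v"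
  proof eventually_elim
    case (elim v)
    hence "H Z < H (inv_H v)"
      by (subst H_inv_H) auto
    thus ?case by simp
  qed
qed

text \<open>Bounds on \<open>inv_H (- v)\<close> are compared after applying the increasing
  \<open>H\<close>, where the values are \<open>- v\<close> and the limit is
  \<open>soldner_props(2)\<close>.\<close>

lemma inv_H_minus_tendsto:
  "((\<lambda>v. inv_H (- v)) \<longlongrightarrow> - ln soldner) (at_left (exp (- euler_mascheroni)))"
proof -
  let ?\<rho> = "exp (- euler_mascheroni) :: real"
  have H_inv: "\<forall>\<^sub>F v in at_left ?\<rho>. H (inv_H (- v)) = - v \<and> v < ?\<rho>"
  proof -
    have "\<forall>\<^sub>F v in at_left ?\<rho>. v \<in> {0<..<?\<rho>}"
      by (intro eventually_at_left_real) simp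
    thus ?thesis
      by eventually_elim (auto intro!: H_inv_H)
  qed
  show ?thesis
  proof (rule order_tendstoI)
    fix a assume "a < - ln soldner"
    hence "H a < - ?\<rho>"
      by (simp flip: soldner_props(2))
    from H_inv show "\<forall>\<^sub>F v in at_left ?\<rho>. a < inv_H (- v)"
    proof eventually_elim
      case (elim v)
      hence "H a < H (inv_H (- v))"
        using \<open>H a < - ?\<rho>\<close> by linarith
      thus ?case by simp
    qed
  next
    fix a assume "- ln soldner < a"
    hence "- ?\<rho> < H a"
      by (simp flip: soldner_props(2))
    hence "\<forall>\<^sub>F v in at_left ?\<rho>. v \<in> {- H a<..<?\<rho>}"
      by (intro eventually_at_left_real) simp
    with H_inv show "\<forall>\<^sub>F v in at_left ?\<rho>. inv_H (- v) < a"
    proof eventually_elim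
      case (elim v)
      hence "H (inv_H (- v)) < H a"
        by auto
      thus ?case by simp
    qed
  qed
qed

theorem theorem2p1:
  shows "(summable (\<lambda>k. res_coeff (Suc k) * exp (- euler_mascheroni * real (Suc k))) \<longrightarrow>
            (\<Sum>k. res_coeff (Suc k) * exp (- euler_mascheroni * real (Suc k))) = ln soldner) \<and>
         filterlim (\<lambda>N. \<Sum>k<N. (-1) ^ k * res_coeff (Suc k) * exp (- euler_mascheroni * real (Suc k)))
           at_top sequentially \<and>
         (\<lambda>k. res_coeff (Suc k) / real (Suc k) * exp (- euler_mascheroni * real (Suc k)))
           sums (soldner - 1) \<and>
         (\<lambda>k. (-1) ^ k * res_coeff (Suc k) / real (Suc k) * exp (- euler_mascheroni * real (Suc k)))
           sums 1 \<and>
         (\<lambda>k. (-1) ^ k * res_coeff (Suc k) / real (Suc k) ^ 2 * exp (- euler_mascheroni * real (Suc k)))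
           sums ln 2"
proof -
  define \<rho> :: real where "\<rho> = exp (- euler_mascheroni)"
  define b :: "nat \<Rightarrow> real" where "b n = inv_H_fps $ n" for n
  have b_nonneg: "b n \<ge> 0" for n
    by (simp add: b_def inv_H_fps_nonneg)
  have b_0: "b 0 = 0"
    by (simp add: b_def)
  have \<rho>_pos: "\<rho> > 0"
    by (simp add: \<rho>_def)
  have pow: "exp (- euler_mascheroni * real n) = \<rho> ^ n" for n
    by (simp add: \<rho>_def mult.commute flip: exp_of_nat_mult)
  have alt: "(- 1) ^ k * res_coeff (Suc k) = b (Suc k)" for k
    by (simp add: res_coeff_eq b_def flip: mult.assoc power_mult_distrib)
  have res: "res_coeff (Suc k) = - ((-1) ^ Suc k * b (Suc k))" for k
    by (simp add: res_coeff_eq b_def)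

  have signed: "(\<lambda>n. (-1) ^ n * c n * v ^ n) = (\<lambda>n. c n * (- v) ^ n)" for c :: "nat \<Rightarrow> real" and v
    by (simp add: power_minus[of v] mult_ac)

  have "filterlim (\<lambda>N. \<Sum>n<N. b n * \<rho> ^ n) at_top sequentially"
  proof (rule nonneg_abel_at_top[OF b_nonneg \<rho>_pos])
    show "(\<lambda>n. b n * v ^ n) sums inv_H v" if "0 < v" "v < \<rho>" for v
      using that by (auto simp: b_def \<rho>_def intro!: inv_H_sums)
    show "filterlim inv_H at_top (at_left \<rho>)"
      unfolding \<rho>_def by (rule inv_H_at_top)
  qed
  \<comment> \<open>The claims count from 1 through \<open>Suc k\<close>; passing to that index
    loses nothing because \<open>b 0 = 0\<close>.\<close>
  hence "filterlim (\<lambda>N. \<Sum>n<Suc N. b n * \<rho> ^ n) at_top sequentially"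
    by (rule filterlim_compose[OF _ filterlim_Suc])
  hence ii: "filterlim (\<lambda>N. \<Sum>k<N. b (Suc k) * \<rho> ^ Suc k) at_top sequentially"
    unfolding sum.lessThan_Suc_shift by (simp add: b_0)

  have iv0: "(\<lambda>n. b n / real n * \<rho> ^ n) sums 1"
  proof (rule nonneg_abel_converse[OF _ \<rho>_pos])
    show "(\<lambda>n. b n / real n * v ^ n) sums (1 - exp (- inv_H v))" if "0 < v" "v < \<rho>" for v
      using that unfolding b_def \<rho>_def by (intro one_minus_exp_inv_H_sums) auto
    have "((\<lambda>v. exp (- inv_H v)) \<longlongrightarrow> 0) (at_left \<rho>)"
      unfolding \<rho>_def
      by (intro filterlim_compose[OF exp_at_bot] filterlim_compose[OF filterlim_uminus_at_bot_at_top] inv_H_at_top)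
    thus "((\<lambda>v. 1 - exp (- inv_H v)) \<longlongrightarrow> 1) (at_left \<rho>)"
      using tendsto_diff[OF tendsto_const[of 1]] by fastforce
  qed (auto simp: b_nonneg)

  have v0: "(\<lambda>n. b n / real n ^ 2 * \<rho> ^ n) sums ln 2"
  proof (rule nonneg_abel_converse[OF _ \<rho>_pos])
    show "(\<lambda>n. b n / real n ^ 2 * v ^ n) sums (Ein (2 * inv_H v) - Ein (inv_H v))" if "0 < v" "v < \<rho>" for v
      using that unfolding b_def \<rho>_def by (intro Ein_diff_inv_H_sums) auto
    show "((\<lambda>v. Ein (2 * inv_H v) - Ein (inv_H v)) \<longlongrightarrow> ln 2) (at_left \<rho>)"
      unfolding \<rho>_def by (rule filterlim_compose[OF Ein_double_diff_tendsto inv_H_at_top])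
  qed (auto simp: b_nonneg)

  have iii0: "(\<lambda>n. (- 1) ^ n * (b n / real n) * \<rho> ^ n) sums (1 - soldner)"
  proof (rule abel_limit[OF _ \<rho>_pos])
    \<comment> \<open>The absolute values are the terms of \<open>iv0\<close>, so the alternating
      series converges absolutely.\<close>
    have "summable (\<lambda>n. norm ((- 1) ^ n * (b n / real n) * \<rho> ^ n))"
      using iv0 \<rho>_pos by (simp add: abs_mult b_nonneg sums_iff)
    thus "summable (\<lambda>n. (- 1) ^ n * (b n / real n) * \<rho> ^ n)"
      by (rule summable_norm_cancel)
    show "(\<lambda>n. (- 1) ^ n * (b n / real n) * v ^ n) sums (1 - exp (- inv_H (- v)))" if "0 < v" "v < \<rho>" for v
      using that unfolding b_def \<rho>_def signed by (intro one_minus_exp_inv_H_sums) auto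
    have "((\<lambda>v. 1 - exp (- inv_H (- v))) \<longlongrightarrow> 1 - exp (- (- ln soldner))) (at_left \<rho>)"
      unfolding \<rho>_def by (intro tendsto_intros inv_H_minus_tendsto)
    thus "((\<lambda>v. 1 - exp (- inv_H (- v))) \<longlongrightarrow> 1 - soldner) (at_left \<rho>)"
      using soldner_props(1) by simp
  qed

  \<comment> \<open>For \<open>n > 0\<close>, \<open>(- 1) ^ n * b n\<close> is
    \<open>- res_coeff n\<close>, which accounts for the sign of the sum.\<close>
  have i0: "(\<lambda>n. (- 1) ^ n * b n * \<rho> ^ n) sums (- ln soldner)"
    if "summable (\<lambda>n. (- 1) ^ n * b n * \<rho> ^ n)"
  proof (rule abel_limit[OF that \<rho>_pos])
    show "(\<lambda>n. (- 1) ^ n * b n * v ^ n) sums inv_H (- v)" if "0 < v" "v < \<rho>" for v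
      using that unfolding b_def \<rho>_def signed by (intro inv_H_sums) auto
    show "((\<lambda>v. inv_H (- v)) \<longlongrightarrow> - ln soldner) (at_left \<rho>)"
      unfolding \<rho>_def by (rule inv_H_minus_tendsto)
  qed

  have shift: "(\<lambda>k. g (Suc k)) sums S" if "g sums S" "g 0 = 0" for g :: "nat \<Rightarrow> real" and S
    using that by (subst sums_Suc_iff) simp

  have i: "(\<lambda>k. res_coeff (Suc k) * \<rho> ^ Suc k) sums ln soldner"
    if "summable (\<lambda>k. res_coeff (Suc k) * \<rho> ^ Suc k)"
  proof -
    have "summable (\<lambda>k. (- 1) ^ Suc k * b (Suc k) * \<rho> ^ Suc k)"
      using summable_minus[OF that] by (simp only: res mult_minus_left minus_minus)
    hence "summable (\<lambda>n. (- 1) ^ n * b n * \<rho> ^ n)"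
      by (subst (asm) summable_Suc_iff)
    from sums_minus[OF shift[OF i0[OF this]]] show ?thesis
      by (simp add: b_0 res mult_minus_left)
  qed

  have iii: "(\<lambda>k. res_coeff (Suc k) / real (Suc k) * \<rho> ^ Suc k) sums (soldner - 1)"
    using sums_minus[OF shift[OF iii0]] by (simp add: b_0 res mult_minus_left del: of_nat_Suc)

  show ?thesis
    unfolding pow alt
    using i ii iii shift[OF iv0] shift[OF v0] by (simp add: sums_iff b_0 del: power_Suc of_nat_Suc)
qed

end
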